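(* Let $\mathcal{H}$ and $\mathcal{G}$ be real finite-dimensional Hilbert spaces, let $g:\mathcal{H}\to\overline{\mathbb{R}}$ and $h:\mathcal{G}\to\overline{\mathbb{R}}$ be proper, convex and lower semicontinuous, let $\varphi:\mathcal{H}\to\mathbb{R}$ be convex and Fréchet differentiable with $\frac1\beta$-Lipschitz continuous gradient for some $\beta>0$, and let $K:\mathcal{H}\to\mathcal{G}$ be linear with adjoint $K^*$. Let $(\gamma_n)_{n\ge0}$ and $(\mu_n)_{n\ge0}$ be sequences of positive numbers with $$0<\inf_{n\ge0}\gamma_n\le\sup_{n\ge0}\gamma_n<\beta,\qquad0<\inf_{n\ge0}\mu_n\le\sup_{n\ge0}\mu_n<+\infty,$$ let $(x_0,y_0)\in\mathcal{H}\times\mathcal{G}$, and for $n\ge0$ let $$x_{n+1}=\operatorname{Prox}_{\gamma_n g}\big(x_n+\gamma_nK^*y_n-\gamma_n\nabla\varphi(x_n)\big),\qquad y_{n+1}=\operatorname{Prox}_{\mu_nh^*}\big(y_n+\mu_nKx_{n+1}\big).$$ Let $\Phi:\mathcal{H}\times\mathcal{G}\to\overline{\mathbb{R}}$, $\Phi(x,y)=g(x)+\varphi(x)+h^*(y)-\langle y,Kx\rangle$. Suppose that $\Phi$ is bounded from below and that $\Phi$ is a KŁ function with $\vartheta(t)=Mt^{1-\theta}$ for some $M>0$ and $0\le\theta<1$. Let $\bar x$ and $\bar y$ be the limits of $(x_n)_{n\ge0}$ and $(y_n)_{n\ge0}$, respectively (which exist under these assumptions). Then: 1. if $\theta=0$,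 there exists $n_0\ge0$ such that $x_n=x_{n_0}$ and $y_n=y_{n_0}$ for all $n\ge n_0$; 2. if $0<\theta\le\frac12$, there exist $c>0$ and $0\le q<1$ such that $\|x_n-\bar x\|\le cq^n$ and $\|y_n-\bar y\|\le cq^n$ for all $n\ge0$; 3. if $\frac12<\theta<1$, there exists $c>0$ such that $\|x_n-\bar x\|\le c\,n^{-\frac{1-\theta}{2\theta-1}}$ and $\|y_n-\bar y\|\le c\,n^{-\frac{1-\theta}{2\theta-1}}$ for all $n\ge1$.
   Context: $\overline{\mathbb{R}}=\mathbb{R}\cup\{+\infty,-\infty\}$. A function is proper if it never takes the value $-\infty$ and is not identically $+\infty$. The conjugate of $f$ is $f^*(x^* )=\sup_x\{\langle x^*,x\rangle-f(x)\}$. For $f$ proper, convex and lower semicontinuous and $\gamma>0$, $\operatorname{Prox}_{\gamma f}(x)$ is the unique minimizer over $y$ of $\gamma f(y)+\frac12\|y-x\|^2$. For a proper lower semicontinuous $f$ on a finite-dimensional Hilbert space, the Fréchet subdifferential $\partial_Ff(x)$ is empty if $f(x)=+\infty$ and otherwise is the set of $x^*$ with $\liminf_{y\to x,\,y\ne x}\frac{f(y)-f(x)-\langle x^*,y-x\rangle}{\|y-x\|}\ge0$. The limiting subdifferential $\partial_Lf(x)$ is empty if $f(x)=+\infty$ and otherwise is the set of $x^*$ for which there are $x_k\to x$ with $f(x_k)\to f(x)$ and $x_k^*\in\partial_Ff(x_k)$ with $x_k^*\to x^*$. "$\Phi$ is a KŁ function with $\vartheta(t)=Mt^{1-\theta}$"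 means: for every $\bar u\in\mathcal{H}\times\mathcal{G}$ with $\partial_L\Phi(\bar u)\ne\emptyset$ there are $\eta\in(0,+\infty]$ and a neighbourhood $U$ of $\bar u$ such that $\vartheta'(\Phi(u)-\Phi(\bar u))\cdot\operatorname{dist}(0,\partial_L\Phi(u))\ge1$ for all $u\in U$ with $\Phi(\bar u)<\Phi(u)<\Phi(\bar u)+\eta$, where $\vartheta'(t)=(1-\theta)Mt^{-\theta}$ and $\operatorname{dist}(0,\emptyset)=+\infty$.
   Formalization: Convergence of (x_n) and (y_n) to x̄ and ȳ is assumed, not derived: the limits need not exist under the stated assumptions (e.g. g=0, h=0, K=0, φ(t)=ln(1+e^{-t}) on the real line, where x_n tends to +∞). *)

theory Defs
  imports "HOL-Analysis.Analysis"
begin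

definition proper :: "('a \<Rightarrow> ereal) \<Rightarrow> bool" where
  "proper f \<longleftrightarrow> (\<forall>x. f x \<noteq> -\<infinity>) \<and> (\<exists>x. f x \<noteq> \<infinity>)"

text \<open>The inequality is only used for functions that never take the value \<open>-\<infinity>\<close>,
  so that the right-hand side never involves a sum of opposite infinities.\<close>

definition convex_ereal :: "('a::real_vector \<Rightarrow> ereal) \<Rightarrow> bool" where
  "convex_ereal f \<longleftrightarrow> (\<forall>x y. \<forall>t::real. 0 < t \<and> t < 1 \<longrightarrow>
     f ((1 - t) *\<^sub>R x + t *\<^sub>R y) \<le> ereal (1 - t) * f x + ereal t * f y)"

definition lsc :: "('a::topological_space \<Rightarrow> ereal) \<Rightarrow> bool" where
  "lsc f \<longleftrightarrow> (\<forall>x. f x \<le> Liminf (at x) f)"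

definition fenchel_conjugate :: "('a::real_inner \<Rightarrow> ereal) \<Rightarrow> 'a \<Rightarrow> ereal" where
  "fenchel_conjugate f p = (SUP x. ereal (p \<bullet> x) - f x)"

text \<open>\<open>Prox \<gamma> f x\<close> is the point usually written \<open>Prox\<close> of \<open>\<gamma> f\<close> at \<open>x\<close>; it is meaningful for
  \<open>\<gamma> > 0\<close> and \<open>f\<close> proper, convex and lower semicontinuous.\<close>

definition Prox :: "real \<Rightarrow> ('a::real_inner \<Rightarrow> ereal) \<Rightarrow> 'a \<Rightarrow> 'a" where
  "Prox \<gamma> f x = (THE y. is_arg_min (\<lambda>y. ereal \<gamma> * f y + ereal (1/2 * (norm (y - x))\<^sup>2)) (\<lambda>_. True) y)"

definition frechet_subdiff :: "('a::real_inner \<Rightarrow> ereal) \<Rightarrow> 'a \<Rightarrow> 'a set" where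
  "frechet_subdiff f x = (if f x = \<infinity> then {} else
     {p. Liminf (at x) (\<lambda>y. (f y - f x - ereal (p \<bullet> (y - x))) / ereal (norm (y - x))) \<ge> 0})"

definition limiting_subdiff :: "('a::real_inner \<Rightarrow> ereal) \<Rightarrow> 'a \<Rightarrow> 'a set" where
  "limiting_subdiff f x = (if f x = \<infinity> then {} else
     {p. \<exists>xs ps. xs \<longlonglongrightarrow> x \<and> (\<lambda>k. f (xs k)) \<longlonglongrightarrow> f x \<and>
          (\<forall>k. ps k \<in> frechet_subdiff f (xs k)) \<and> ps \<longlonglongrightarrow> p})"

text \<open>Distance of a set to the origin, with value \<open>\<infinity>\<close> for the empty set
  (whereas \<open>infdist\<close> is \<open>0\<close> there).\<close>

definition dist_origin :: "'a::real_normed_vector set \<Rightarrow> ereal" where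
  "dist_origin S = (INF p\<in>S. ereal (norm p))"

text \<open>If the limiting subdifferential of a proper \<open>f\<close> at \<open>u0\<close> is nonempty, then \<open>f u0\<close> is finite;
  hence \<open>f u - f u0\<close> is finite and positive in the last line and \<open>real_of_ereal\<close> is harmless.
  In particular \<open>deriv \<psi>\<close> is only evaluated at positive arguments.\<close>

definition KL_function :: "('a::real_inner \<Rightarrow> ereal) \<Rightarrow> (real \<Rightarrow> real) \<Rightarrow> bool" where
  "KL_function f \<psi> \<longleftrightarrow>
     (\<forall>u0. limiting_subdiff f u0 \<noteq> {} \<longrightarrow>
       (\<exists>\<eta>::ereal. \<exists>U. 0 < \<eta> \<and> open U \<and> u0 \<in> U \<and>
         (\<forall>u\<in>U. f u0 < f u \<and> f u < f u0 + \<eta> \<longrightarrow>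
            ereal (deriv \<psi> (real_of_ereal (f u - f u0))) * dist_origin (limiting_subdiff f u) \<ge> 1)))"

end

theory Submission
  imports Defs
begin

text \<open>Along the iteration \<open>\<Phi>\<close> decreases by at least a multiple of the squared step length, and
  \<open>\<Phi>\<close> has at the new iterate a subgradient whose norm is at most a multiple of the step length.
  That subgradient minorises \<open>\<Phi>\<close> up to a quadratic error, which forces the values of \<open>\<Phi>\<close> to converge
  to its value at the limit point. Hence the KL inequality applies eventually: if \<open>r\<^sub>n\<close> is the gap
  of the values and \<open>d\<^sub>n\<close> the step length, then \<open>r\<^sub>n powr \<theta> \<le> C d\<^sub>n\<close> and \<open>a d\<^sub>n\<^sub>+\<^sub>1\<^sup>2 \<le> r\<^sub>n - r\<^sub>n\<^sub>+\<^sub>1\<close>.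
  For \<open>\<theta> \<le> 1/2\<close> this gives linear decay of \<open>r\<close>; for \<open>\<theta> > 1/2\<close> it makes \<open>r\<^sub>n powr (1 - 2 \<theta>)\<close> grow at
  least linearly. Concavity of \<open>t powr (1 - \<theta>)\<close> bounds the remaining path length in terms of
  \<open>r\<close>.\<close>

subsection \<open>Finite-dimensional inner product spaces\<close>

text \<open>The obstacle is the coupling term. It makes \<Phi> nonconvex in general, so the
  subgradients of \<open>g\<close> and of the conjugate of \<open>h\<close> that the proximal steps
  provide do not combine into a global affine minorant of \<Phi>. They do so up to a quadratic error
  whose constant \<open>C\<close> bounds \<open>K\<close>. This one inequality serves twice: divided
  by the distance it gives a Frechet subgradient, and evaluated at the limit point it bounds the
  values from above, where lower semicontinuity bounds them only from below. The gradient estimate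
  costs \<open>1 / \<beta>\<close> times the squared primal step and the proximal step gains
  \<open>1 / \<gamma> n\<close> times it, so the bound on the step sizes by \<beta> is what makes
  the iteration descend. The KL inequality is silent where the gap is zero; runs that reach the
  limit value are split off and shown to be stationary. The initial point may lie outside the domain
  of \<Phi>, so the analysis starts after one step. The spaces are \<open>real_inner\<close> types
  with a finite spanning set, hence compactness, boundedness of \<open>K\<close> and the adjoint
  identity are derived from an orthonormal basis.\<close>

lemma finite_dim_orthonormal_basis:
  assumes "\<exists>B :: 'a::real_inner set. finite B \<and> span B = UNIV"
  obtains B :: "'a::real_inner set" where "finite B" "\<And>b. b \<in> B \<Longrightarrow> norm b = 1"
    "\<And>v. (\<Sum>b\<in>B. (v \<bullet> b) *\<^sub>R b) = v"
proof -
  obtain C :: "'a set" where C: "finite C" "span C = UNIV" "pairwise orthogonal C"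
    using assms basis_orthogonal by metis
  \<comment> \<open>\<open>C\<close> may contain 0, which cannot be normalised and contributes
    nothing to the span.\<close>
  define B where "B = (\<lambda>b. b /\<^sub>R norm b) ` (C - {0})"
  have fin: "finite B"
    using C(1) by (simp add: B_def)
  have norm1: "norm b = 1" if b: "b \<in> B" for b
  proof -
    obtain c where "b = c /\<^sub>R norm c" "c \<noteq> 0" using b unfolding B_def by blast
    then show ?thesis by simp
  qed
  have orth: "pairwise orthogonal B"
    using C(3) by (auto simp: B_def pairwise_def orthogonal_def)
  have "C \<subseteq> span B"
  proof
    fix c assume "c \<in> C"
    show "c \<in> span B"
    proof (cases "c = 0")
      case False
      then have "norm c *\<^sub>R (c /\<^sub>R norm c) \<in> span B"
        using \<open>c \<in> C\<close> by (intro span_scale span_base) (auto simp: B_def)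
      then show ?thesis using False by simp
    qed (simp add: span_zero)
  qed
  then have "span B = UNIV"
    using C(2) by (metis span_mono span_span top.extremum_uniqueI)
  then show thesis
    using that[OF fin norm1] orthonormal_basis_expand[OF orth norm1 _ fin] by simp
qed

text \<open>Induction on the set: a new vector \<open>a\<close> brings a coefficient from the
  compact interval \<open>{-r..r}\<close>, so the larger box is a continuous image of a product of
  compact sets.\<close>

lemma compact_coordinate_box:
  fixes B :: "'a::real_normed_vector set"
  assumes "finite B"
  shows "compact {v. \<exists>c. (\<forall>b\<in>B. \<bar>c b\<bar> \<le> r) \<and> v = (\<Sum>b\<in>B. c b *\<^sub>R b)}"
  using assms
proof (induction B)
  case empty
  then show ?case by simp
next
  case (insert a B)
  let ?S = "{v. \<exists>c. (\<forall>b\<in>B. \<bar>c b\<bar> \<le> r) \<and> v = (\<Sum>b\<in>B. c b *\<^sub>R b)}"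
  have "compact ((\<lambda>(t, v). t *\<^sub>R a + v) ` ({-r..r} \<times> ?S))"
  proof (rule compact_continuous_image)
    show "continuous_on ({-r..r} \<times> ?S) (\<lambda>(t, v). t *\<^sub>R a + v)"
      unfolding split_beta by (intro continuous_intros)
    show "compact ({-r..r} \<times> ?S)"
      by (rule compact_Times[OF compact_Icc insert.IH])
  qed
  also have "(\<lambda>(t, v). t *\<^sub>R a + v) ` ({-r..r} \<times> ?S) =
    {v. \<exists>c. (\<forall>b\<in>insert a B. \<bar>c b\<bar> \<le> r) \<and> v = (\<Sum>b\<in>insert a B. c b *\<^sub>R b)}" (is "?L = ?R")
  proof (intro equalityI subsetI)
    fix w assume "w \<in> ?L"
    then obtain p where "p \<in> {-r..r} \<times> ?S" "w = (case p of (t, v) \<Rightarrow> t *\<^sub>R a + v)"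
      by (rule imageE)
    then obtain t v where tv: "t \<in> {-r..r}" "v \<in> ?S" "w = t *\<^sub>R a + v"
      using that[of "fst p" "snd p"] by (simp add: mem_Times_iff split_beta)
    from tv(2) obtain c where "\<forall>b\<in>B. \<bar>c b\<bar> \<le> r" "v = (\<Sum>b\<in>B. c b *\<^sub>R b)"
      by (elim CollectE exE conjE)
    with tv(1,3) have tc: "\<bar>t\<bar> \<le> r" "\<forall>b\<in>B. \<bar>c b\<bar> \<le> r" "w = t *\<^sub>R a + (\<Sum>b\<in>B. c b *\<^sub>R b)"
      by (auto simp: abs_le_iff)
    have "(\<Sum>b\<in>B. (c(a := t)) b *\<^sub>R b) = (\<Sum>b\<in>B. c b *\<^sub>R b)"
      using insert.hyps by (intro sum.cong) auto
    then have "w = (\<Sum>b\<in>insert a B. (c(a := t)) b *\<^sub>R b)"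
      using tc insert.hyps by simp
    moreover have "\<forall>b\<in>insert a B. \<bar>(c(a := t)) b\<bar> \<le> r"
      using tc by simp
    ultimately show "w \<in> ?R" by (intro CollectI exI[of _ "c(a := t)"] conjI)
  next
    fix w assume "w \<in> ?R"
    then obtain c where c: "\<forall>b\<in>insert a B. \<bar>c b\<bar> \<le> r" "w = (\<Sum>b\<in>insert a B. c b *\<^sub>R b)"
      by (elim CollectE exE conjE)
    show "w \<in> ?L"
      using c insert.hyps
      by (intro image_eqI[of _ _ "(c a, \<Sum>b\<in>B. c b *\<^sub>R b)"]) (auto simp: abs_le_iff)
  qed
  finally show ?case .
qed

text \<open>Cauchy-Schwarz bounds each coordinate in an orthonormal basis by the norm, so the ball
  is a closed subset of a compact coordinate box.\<close>

lemma compact_cball_finite_dim: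
  fixes z :: "'a::real_inner"
  assumes "\<exists>B :: 'a set. finite B \<and> span B = UNIV"
  shows "compact (cball z r)"
proof -
  obtain B :: "'a set" where B: "finite B" "\<And>b. b \<in> B \<Longrightarrow> norm b = 1"
    "\<And>v. (\<Sum>b\<in>B. (v \<bullet> b) *\<^sub>R b) = v"
    using finite_dim_orthonormal_basis[OF assms] by blast
  define R where "R = norm z + r"
  have "cball z r \<subseteq> {v. \<exists>c. (\<forall>b\<in>B. \<bar>c b\<bar> \<le> R) \<and> v = (\<Sum>b\<in>B. c b *\<^sub>R b)}"
  proof
    fix v assume "v \<in> cball z r"
    then have "norm v \<le> R"
      using norm_triangle_sub[of v z] by (simp add: R_def dist_norm norm_minus_commute)
    then have "\<bar>v \<bullet> b\<bar> \<le> R" if "b \<in> B" for b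
      using Cauchy_Schwarz_ineq2[of v b] B(2)[OF that] by simp
    then show "v \<in> {v. \<exists>c. (\<forall>b\<in>B. \<bar>c b\<bar> \<le> R) \<and> v = (\<Sum>b\<in>B. c b *\<^sub>R b)}"
      using B(3)[of v] by (intro CollectI exI[of _ "\<lambda>b. v \<bullet> b"]) auto
  qed
  then show ?thesis
    using closed_Int_compact[OF closed_cball compact_coordinate_box[OF B(1)], of z r R]
    by (simp only: inf.absorb1)
qed

text \<open>Besides continuity of \<open>K\<close>, this provides the constant of the quadratic
  error caused by the coupling term.\<close>

lemma linear_bounded_finite_dim:
  fixes K :: "'a::real_inner \<Rightarrow> 'b::real_normed_vector"
  assumes "\<exists>B :: 'a set. finite B \<and> span B = UNIV" and "linear K"
  obtains C where "C \<ge> 0" "\<And>v. norm (K v) \<le> C * norm v"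
proof -
  obtain B :: "'a set" where B: "finite B" "\<And>b. b \<in> B \<Longrightarrow> norm b = 1"
    "\<And>v. (\<Sum>b\<in>B. (v \<bullet> b) *\<^sub>R b) = v"
    using finite_dim_orthonormal_basis[OF assms(1)] by blast
  show thesis
  proof (rule that)
    show "(\<Sum>b\<in>B. norm (K b)) \<ge> 0" by (simp add: sum_nonneg)
    fix v
    have "K v = K (\<Sum>b\<in>B. (v \<bullet> b) *\<^sub>R b)"
      using B(3) by simp
    also have "\<dots> = (\<Sum>b\<in>B. (v \<bullet> b) *\<^sub>R K b)"
      using \<open>linear K\<close> by (simp add: linear_sum linear_cmul)
    also have "norm \<dots> \<le> (\<Sum>b\<in>B. norm v * norm (K b))"
    proof (rule sum_norm_le)
      fix b assume "b \<in> B"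
      then show "norm ((v \<bullet> b) *\<^sub>R K b) \<le> norm v * norm (K b)"
        using Cauchy_Schwarz_ineq2[of v b] B(2) by (simp add: mult_right_mono)
    qed
    finally show "norm (K v) \<le> (\<Sum>b\<in>B. norm (K b)) * norm v"
      by (simp add: mult.commute flip: sum_distrib_left)
  qed
qed

text \<open>\<open>adjoint\<close> is defined by choice, so its identity is available only once some
  map is known to satisfy it; the basis expansion supplies that map.\<close>

lemma adjoint_works_finite_dim:
  fixes K :: "'a::real_inner \<Rightarrow> 'b::real_inner"
  assumes "\<exists>B :: 'a set. finite B \<and> span B = UNIV" and "linear K"
  shows "v \<bullet> adjoint K w = K v \<bullet> w"
proof -
  obtain B :: "'a set" where "finite B" "\<And>b. b \<in> B \<Longrightarrow> norm b = 1"
    and B: "\<And>v. (\<Sum>b\<in>B. (v \<bullet> b) *\<^sub>R b) = v"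
    using finite_dim_orthonormal_basis[OF assms(1)] by blast
  have eq: "K v \<bullet> w = v \<bullet> (\<Sum>b\<in>B. (K b \<bullet> w) *\<^sub>R b)" for v w
  proof -
    have "K v \<bullet> w = K (\<Sum>b\<in>B. (v \<bullet> b) *\<^sub>R b) \<bullet> w"
      using B by simp
    also have "\<dots> = v \<bullet> (\<Sum>b\<in>B. (K b \<bullet> w) *\<^sub>R b)"
      using \<open>linear K\<close>
      by (simp add: linear_sum linear_cmul inner_sum_left inner_sum_right mult.commute)
    finally show ?thesis .
  qed
  have "adjoint K = (\<lambda>w. \<Sum>b\<in>B. (K b \<bullet> w) *\<^sub>R b)"
    by (intro adjoint_unique allI eq)
  then show ?thesis using eq[of v w, symmetric] by (simp only:)
qed

subsection \<open>Lower semicontinuity\<close>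

lemma lscI_nhds:
  assumes "\<And>x c. c < f x \<Longrightarrow> eventually (\<lambda>y. c < f y) (nhds x)"
  shows "lsc f"
  unfolding lsc_def le_Liminf_iff
proof (intro allI impI)
  fix x c assume "c < f x"
  from assms[OF this] show "eventually (\<lambda>y. c < f y) (at x)"
    by (simp add: eventually_at_filter eventually_mono)
qed

text \<open>\<open>lsc\<close> speaks of the punctured filter \<open>at x\<close>; the strict
  inequality at \<open>x\<close> itself fills in the centre. Full neighbourhoods are what
  composition requires, since an inner map such as \<open>fst\<close> can take its value at
  \<open>x\<close> again nearby.\<close>

lemma lsc_eventually_nhds:
  assumes "lsc f" "c < f x"
  shows "eventually (\<lambda>y. c < f y) (nhds x)"
proof -
  have "eventually (\<lambda>y. c < f y) (at x)"
    using assms by (intro less_LiminfD) (auto simp: lsc_def intro: less_le_trans)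
  then show ?thesis
    using assms(2) unfolding eventually_at_filter by (elim eventually_mono) (metis UNIV_I)
qed

text \<open>A real number below the sum splits into real numbers below the two summands because
  neither summand is \<open>-\<infinity>\<close>; both bounds then persist on a
  neighbourhood.\<close>

lemma lsc_add:
  assumes "lsc f" "lsc g" "\<And>x. f x \<noteq> -\<infinity>" "\<And>x. g x \<noteq> -\<infinity>"
  shows "lsc (\<lambda>x. f x + g x)"
proof (rule lscI_nhds)
  fix x c assume "c < f x + g x"
  then obtain k where k: "c < ereal k" "ereal k < f x + g x"
    using ereal_dense2 by blast
  have "\<exists>a b. ereal a < f x \<and> ereal b < g x \<and> k = a + b"
  proof (cases "f x"; cases "g x")
    fix r s assume rs: "f x = ereal r" "g x = ereal s"
    then have "k < r + s" using k(2) by simp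
    then show ?thesis using rs
      by (intro exI[of _ "r - (r + s - k) / 2"] exI[of _ "s - (r + s - k) / 2"])
         (auto simp: field_simps)
  next
    fix r assume "f x = ereal r" "g x = \<infinity>"
    then show ?thesis by (intro exI[of _ "r - 1"] exI[of _ "k - r + 1"]) auto
  next
    fix s assume "f x = \<infinity>" "g x = ereal s"
    then show ?thesis by (intro exI[of _ "k - s + 1"] exI[of _ "s - 1"]) auto
  next
    assume "f x = \<infinity>" "g x = \<infinity>"
    then show ?thesis by (intro exI[of _ k] exI[of _ 0]) auto
  qed (use assms(3,4) in auto)
  then obtain a b where ab: "ereal a < f x" "ereal b < g x" "k = a + b" by blast
  show "eventually (\<lambda>y. c < f y + g y) (nhds x)"
    using lsc_eventually_nhds[OF assms(1) ab(1)] lsc_eventually_nhds[OF assms(2) ab(2)]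
  proof eventually_elim
    case (elim y)
    have "ereal k < f y + g y"
      using ereal_add_strict_mono2[OF elim] ab(3) by simp
    with k(1) show ?case by (rule less_trans)
  qed
qed

lemma lsc_cmult:
  assumes "lsc f" "c > 0"
  shows "lsc (\<lambda>x. ereal c * f x)"
proof (rule lscI_nhds)
  fix x k assume "k < ereal c * f x"
  then have "k / ereal c < f x" 
    using assms(2) by (simp add: ereal_divide_less_iff mult.commute)
  from lsc_eventually_nhds[OF assms(1) this]
  show "eventually (\<lambda>y. k < ereal c * f y) (nhds x)"
    using assms(2) by (simp add: ereal_divide_less_iff mult.commute)
qed

lemma lsc_compose:
  assumes "lsc f" "\<And>x. isCont t x"
  shows "lsc (\<lambda>x. f (t x))"
proof (rule lscI_nhds)
  fix x c assume "c < f (t x)"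
  from lsc_eventually_nhds[OF assms(1) this]
  show "eventually (\<lambda>y. c < f (t y)) (nhds x)"
    using assms(2)[of x] filterlim_iff[of t "nhds (t x)" "nhds x"]
    unfolding isCont_def tendsto_at_iff_tendsto_nhds by blast
qed

lemma lsc_continuous:
  assumes "\<And>x. isCont f x"
  shows "lsc (\<lambda>x. ereal (f x))"
proof (rule lscI_nhds)
  fix x c assume "c < ereal (f x)"
  moreover have "((\<lambda>x. ereal (f x)) \<longlongrightarrow> ereal (f x)) (nhds x)"
    using assms[of x] by (simp add: isCont_def tendsto_at_iff_tendsto_nhds tendsto_ereal)
  ultimately show "eventually (\<lambda>y. c < ereal (f y)) (nhds x)"
    by (rule order_tendstoD(1)[rotated])
qed

text \<open>Without a minimiser every \<open>z\<close> has a better point \<open>m z\<close>, and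
  \<open>f\<close> stays above \<open>f (m z)\<close> near \<open>z\<close>. Finitely many such
  neighbourhoods cover \<open>S\<close>; the one that contains the best of the corresponding points
  \<open>m c\<close> yields a still better one among them.\<close>

lemma lsc_attains_inf:
  fixes f :: "'a::topological_space \<Rightarrow> ereal"
  assumes "lsc f" "compact S" "S \<noteq> {}"
  obtains z where "z \<in> S" "\<And>y. y \<in> S \<Longrightarrow> f z \<le> f y"
proof (rule ccontr)
  assume "\<not> thesis"
  then have "\<forall>z\<in>S. \<exists>y\<in>S. f y < f z"
    using that by (meson not_less)
  then obtain m where m: "\<And>z. z \<in> S \<Longrightarrow> m z \<in> S \<and> f (m z) < f z"
    by metis
  have "\<exists>U. open U \<and> z \<in> U \<and> (\<forall>y\<in>U. f (m z) < f y)" if "z \<in> S" for z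
    using lsc_eventually_nhds[OF assms(1), of "f (m z)" z] m[OF that]
    by (auto simp: eventually_nhds)
  then obtain U where U: "\<And>z. z \<in> S \<Longrightarrow> open (U z) \<and> z \<in> U z \<and> (\<forall>y\<in>U z. f (m z) < f y)"
    by metis
  have "\<And>z. z \<in> S \<Longrightarrow> open (U z)" "S \<subseteq> (\<Union>z\<in>S. U z)" using U by auto
  then obtain C where C: "C \<subseteq> S" "finite C" "S \<subseteq> (\<Union>z\<in>C. U z)"
    using compactE_image[OF assms(2)] by metis
  then have "C \<noteq> {}" using assms(3) by auto
  then obtain c where c: "c \<in> C" "\<And>z. z \<in> C \<Longrightarrow> f (m c) \<le> f (m z)"
    using C(2) arg_min_if_finite[of C "\<lambda>z. f (m z)"] by (metis not_less)
  have "m c \<in> S" using m C(1) c(1) by blast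
  then obtain z where "z \<in> C" "m c \<in> U z" using C(3) by blast
  then have "f (m z) < f (m c)" using U C(1) by blast
  then show False using c(2)[OF \<open>z \<in> C\<close>] by simp
qed

subsection \<open>Proximal points and conjugates\<close>

text \<open>A minorant of linear growth suffices for coercivity of the proximal objective and needs
  no separation argument: \<open>f\<close> attains a minimum on a unit ball around a point of its
  domain, and convexity carries that bound outwards along rays.\<close>

lemma convex_lsc_lower_bound:
  fixes f :: "'a::real_inner \<Rightarrow> ereal"
  assumes fd: "\<exists>B :: 'a set. finite B \<and> span B = UNIV"
    and f: "proper f" "convex_ereal f" "lsc f"
  obtains a b where "b \<ge> 0" "\<And>y. ereal (a - b * norm (y - z)) \<le> f y"
proof -
  obtain x0 where x0: "f x0 \<noteq> \<infinity>" using f(1) by (auto simp: proper_def)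
  then obtain r where r: "f x0 = ereal r"
    using f(1) by (cases "f x0") (auto simp: proper_def)
  obtain p where p: "p \<in> cball x0 1" "\<And>y. y \<in> cball x0 1 \<Longrightarrow> f p \<le> f y"
    using lsc_attains_inf[OF f(3) compact_cball_finite_dim[OF fd, of x0 1]] by auto
  have "f p \<le> ereal r" using p(2)[of x0] r by simp
  then obtain m where m: "f p = ereal m"
    using f(1) by (cases "f p") (auto simp: proper_def)
  have "m \<le> r" using \<open>f p \<le> ereal r\<close> m by simp
  have bound: "ereal (m - (r - m) * norm (y - x0)) \<le> f y" for y
  proof (cases "norm (y - x0) \<le> 1")
    case True
    then have "ereal m \<le> f y" using p(2)[of y] m by (simp add: dist_norm norm_minus_commute)
    moreover have "ereal (m - (r - m) * norm (y - x0)) \<le> ereal m"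
      using \<open>m \<le> r\<close> by simp
    ultimately show ?thesis by (rule order_trans[rotated])
  next
    case False
    define s where "s = norm (y - x0)"
    have s: "s > 1" using False by (simp add: s_def)
    show ?thesis
    proof (cases "f y")
      case (real v)
      \<comment> \<open>\<open>u\<close> is the point of the segment from \<open>x0\<close> to
        \<open>y\<close> at distance 1 from \<open>x0\<close>, where \<open>m\<close> is still a
        lower bound.\<close>
      define u where "u = (1 - 1/s) *\<^sub>R x0 + (1/s) *\<^sub>R y"
      have "u - x0 = (1/s) *\<^sub>R (y - x0)" by (simp add: u_def algebra_simps)
      then have "norm (u - x0) = 1 / s * s" using s unfolding s_def by simp
      then have "norm (u - x0) = 1" using s by simp
      then have "ereal m \<le> f u" using p(2)[of u] m by (simp add: dist_norm norm_minus_commute)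
      also have "\<dots> \<le> ereal (1 - 1/s) * f x0 + ereal (1/s) * f y"
        using f(2) s unfolding convex_ereal_def u_def by simp
      finally have "m \<le> (1 - 1/s) * r + (1/s) * v" using r real by simp
      then have "s * m \<le> s * ((1 - 1/s) * r + (1/s) * v)" using s by (intro mult_left_mono) auto
      also have "\<dots> = (s - 1) * r + v" using s by (simp add: field_simps)
      finally have "v \<ge> r - (r - m) * s" by (simp add: algebra_simps)
      then have "m - (r - m) * s \<le> v" using \<open>m \<le> r\<close> by linarith
      then show ?thesis using real by (simp add: s_def)
    qed (use f(1) in \<open>auto simp: proper_def\<close>)
  qed
  show thesis
  proof (rule that)
    show "r - m \<ge> 0" using \<open>m \<le> r\<close> by simp
    fix y
    have "norm (y - x0) \<le> norm (y - z) + norm (z - x0)"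
      using norm_triangle_ineq[of "y - z" "z - x0"] by simp
    then have "(r - m) * norm (y - x0) \<le> (r - m) * (norm (y - z) + norm (z - x0))"
      using \<open>m \<le> r\<close> by (intro mult_left_mono) auto
    then have "ereal ((m - (r - m) * norm (z - x0)) - (r - m) * norm (y - z)) \<le> ereal (m - (r - m) * norm (y - x0))"
      by (simp add: algebra_simps)
    also note bound
    finally show "ereal ((m - (r - m) * norm (z - x0)) - (r - m) * norm (y - z)) \<le> f y" .
  qed
qed

lemma lsc_prox_objective:
  fixes f :: "'a::real_inner \<Rightarrow> ereal"
  assumes "lsc f" "\<And>x. f x \<noteq> -\<infinity>" "\<gamma> > 0"
  shows "lsc (\<lambda>y. ereal \<gamma> * f y + ereal (1/2 * (norm (y - x))\<^sup>2))"
proof (rule lsc_add)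
  show "lsc (\<lambda>y. ereal (1/2 * (norm (y - x))\<^sup>2))"
    by (intro lsc_continuous continuous_intros)
  show "ereal \<gamma> * f y \<noteq> -\<infinity>" for y
    using assms(2)[of y] assms(3) by (cases "f y") auto
qed (use assms in \<open>auto intro: lsc_cmult\<close>)

lemma prox_objective_attains:
  fixes f :: "'a::real_inner \<Rightarrow> ereal"
  assumes fd: "\<exists>B :: 'a set. finite B \<and> span B = UNIV"
    and f: "proper f" "convex_ereal f" "lsc f" and "\<gamma> > 0"
  obtains p where "\<And>y. ereal \<gamma> * f p + ereal (1/2 * (norm (p - x))\<^sup>2)
    \<le> ereal \<gamma> * f y + ereal (1/2 * (norm (y - x))\<^sup>2)"
proof -
  let ?F = "\<lambda>y. ereal \<gamma> * f y + ereal (1/2 * (norm (y - x))\<^sup>2)"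
  obtain x0 r where x0: "f x0 = ereal r"
    using f(1) unfolding proper_def by (metis ereal_cases)
  obtain a b where ab: "b \<ge> 0" "\<And>y. ereal (a - b * norm (y - x)) \<le> f y"
    using convex_lsc_lower_bound[OF fd f] by blast
  define v where "v = \<gamma> * r + 1/2 * (norm (x0 - x))\<^sup>2"
  have Fx0: "?F x0 = ereal v" using x0 by (simp add: v_def)
  \<comment> \<open>For \<open>s > R\<close> one has \<open>s \<ge> 1\<close> and
    \<open>s / 2 - \<gamma> * b \<ge> \<bar>v - \<gamma> * a\<bar>\<close>, so the square beats the
    linear minorant and the objective is at least its value \<open>v\<close> at \<open>x0\<close>.
    The last summand keeps \<open>x0\<close> inside the ball.\<close>
  define R where "R = 2 * (\<gamma> * b + \<bar>v - \<gamma> * a\<bar> + 1) + norm (x0 - x)"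
  have gb: "\<gamma> * b \<ge> 0" using ab(1) \<open>\<gamma> > 0\<close> by simp
  have R: "R \<ge> 1"
    using gb norm_ge_zero[of "x0 - x"] abs_ge_zero[of "v - \<gamma> * a"] unfolding R_def by argo
  have x0R: "norm (x0 - x) \<le> R"
    using gb abs_ge_zero[of "v - \<gamma> * a"] unfolding R_def by argo
  have far: "ereal v \<le> ?F y" if "y \<notin> cball x R" for y
  proof -
    define s where "s = norm (y - x)"
    have s: "s > R" using that by (simp add: s_def dist_norm norm_minus_commute)
    have "1 * \<bar>v - \<gamma> * a\<bar> \<le> s * (s / 2 - \<gamma> * b)"
    proof (rule mult_mono)
      show "\<bar>v - \<gamma> * a\<bar> \<le> s / 2 - \<gamma> * b"
        using s norm_ge_zero[of "x0 - x"] unfolding R_def by argo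
    qed (use s R in linarith)+
    then have "v - \<gamma> * a \<le> s * (s / 2 - \<gamma> * b)"
      using abs_ge_self[of "v - \<gamma> * a"] by (metis mult_1 order_trans)
    then have "v \<le> \<gamma> * (a - b * s) + 1/2 * s\<^sup>2"
      by (simp add: algebra_simps power2_eq_square)
    then have "ereal v \<le> ereal \<gamma> * ereal (a - b * s) + ereal (1/2 * s\<^sup>2)" by simp
    also have "\<dots> \<le> ?F y"
      unfolding s_def using \<open>\<gamma> > 0\<close> by (intro add_right_mono ereal_mult_left_mono ab) auto
    finally show ?thesis .
  qed
  have "cball x R \<noteq> {}" using R by auto
  have "lsc ?F" using f(1,3) \<open>\<gamma> > 0\<close> by (intro lsc_prox_objective) (auto simp: proper_def)
  then obtain p where p: "p \<in> cball x R" "\<And>y. y \<in> cball x R \<Longrightarrow> ?F p \<le> ?F y"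
    using lsc_attains_inf[OF _ compact_cball_finite_dim[OF fd, of x R] \<open>cball x R \<noteq> {}\<close>] by blast
  have "x0 \<in> cball x R"
    using x0R by (simp add: dist_norm norm_minus_commute)
  then have "?F p \<le> ereal v" using p(2)[of x0] Fx0 by simp
  then have "?F p \<le> ?F y" for y
    using p(2)[of y] far[of y] order_trans by blast
  then show thesis by (rule that)
qed

text \<open>Minimality is tested on the segment from \<open>p\<close> to \<open>y\<close>. Convexity
  bounds \<open>f\<close> there, a factor \<open>t\<close> cancels, and the quadratic term vanishes
  as \<open>t\<close> tends to 0.\<close>

lemma prox_objective_minimizer:
  fixes f :: "'a::real_inner \<Rightarrow> ereal"
  assumes f: "proper f" "convex_ereal f" and "\<gamma> > 0"
    and min: "\<And>y. ereal \<gamma> * f p + ereal (1/2 * (norm (p - x))\<^sup>2)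
      \<le> ereal \<gamma> * f y + ereal (1/2 * (norm (y - x))\<^sup>2)"
  shows "f p \<noteq> \<infinity>" and "f p + ereal (((x - p) /\<^sub>R \<gamma>) \<bullet> (y - p)) \<le> f y"
proof -
  obtain x0 r where x0: "f x0 = ereal r"
    using f(1) unfolding proper_def by (metis ereal_cases)
  show fin: "f p \<noteq> \<infinity>"
    using min[of x0] x0 \<open>\<gamma> > 0\<close> by auto
  then obtain u where u: "f p = ereal u"
    using f(1) unfolding proper_def by (metis ereal_cases)
  show "f p + ereal (((x - p) /\<^sub>R \<gamma>) \<bullet> (y - p)) \<le> f y"
  proof (cases "f y")
    case (real v)
    have "0 \<le> \<gamma> * (v - u) + (p - x) \<bullet> (y - p) + t / 2 * (norm (y - p))\<^sup>2" if t: "0 < t" "t < 1" for t :: real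
    proof -
      let ?z = "(1 - t) *\<^sub>R p + t *\<^sub>R y"
      have "?z - x = (p - x) + t *\<^sub>R (y - p)" by (simp add: algebra_simps)
      then have n: "(norm (?z - x))\<^sup>2 = (norm (p - x))\<^sup>2 + 2 * t * ((p - x) \<bullet> (y - p)) + t\<^sup>2 * (norm (y - p))\<^sup>2"
        by (simp only: power2_norm_eq_inner)
           (simp add: inner_add_left inner_add_right inner_commute power2_eq_square)
      have "ereal \<gamma> * ereal u + ereal (1/2 * (norm (p - x))\<^sup>2) \<le> ereal \<gamma> * f ?z + ereal (1/2 * (norm (?z - x))\<^sup>2)"
        using min[of ?z] u by simp
      also have "\<dots> \<le> ereal \<gamma> * (ereal (1 - t) * f p + ereal t * f y) + ereal (1/2 * (norm (?z - x))\<^sup>2)"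
        using f(2) t \<open>\<gamma> > 0\<close> unfolding convex_ereal_def
        by (intro add_right_mono ereal_mult_left_mono) auto
      finally have "\<gamma> * u + 1/2 * (norm (p - x))\<^sup>2 \<le> \<gamma> * ((1 - t) * u + t * v) + 1/2 * (norm (?z - x))\<^sup>2"
        using u real by simp
      then have "0 \<le> t * (\<gamma> * (v - u) + (p - x) \<bullet> (y - p) + t / 2 * (norm (y - p))\<^sup>2)"
        unfolding n by (simp add: algebra_simps power2_eq_square)
      then show ?thesis using t by (simp add: zero_le_mult_iff)
    qed
    then have ev: "eventually (\<lambda>t. 0 \<le> \<gamma> * (v - u) + (p - x) \<bullet> (y - p) + t / 2 * (norm (y - p))\<^sup>2) (at_right 0)"
      using eventually_at_right_real[of 0 1] by (auto elim: eventually_mono)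
    have "((\<lambda>t. \<gamma> * (v - u) + (p - x) \<bullet> (y - p) + t / 2 * (norm (y - p))\<^sup>2)
       \<longlongrightarrow> \<gamma> * (v - u) + (p - x) \<bullet> (y - p) + 0 / 2 * (norm (y - p))\<^sup>2) (at_right 0)"
      by (intro tendsto_intros) auto
    from tendsto_lowerbound[OF this ev]
    have "0 \<le> \<gamma> * (v - u) - (x - p) \<bullet> (y - p)" by (simp add: inner_diff_left)
    then have "u + ((x - p) \<bullet> (y - p)) / \<gamma> \<le> v" using \<open>\<gamma> > 0\<close> by (simp add: field_simps)
    then show ?thesis using u real by (simp add: divide_inverse mult.commute)
  qed (use f(1) in \<open>auto simp: proper_def\<close>)
qed

text \<open>\<open>Prox\<close> is a definite description, so uniqueness has to precede any use of
  it: the subgradient inequalities at two minimisers add up to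
  \<open>((q - p) \<bullet> (q - p)) / \<gamma> \<le> 0\<close>.\<close>

lemma Prox_subgradient:
  fixes f :: "'a::real_inner \<Rightarrow> ereal"
  assumes fd: "\<exists>B :: 'a set. finite B \<and> span B = UNIV"
    and f: "proper f" "convex_ereal f" "lsc f" and "\<gamma> > 0"
  shows "f (Prox \<gamma> f x) \<noteq> \<infinity>"
    and "f (Prox \<gamma> f x) + ereal (((x - Prox \<gamma> f x) /\<^sub>R \<gamma>) \<bullet> (y - Prox \<gamma> f x)) \<le> f y"
proof -
  let ?F = "\<lambda>y. ereal \<gamma> * f y + ereal (1/2 * (norm (y - x))\<^sup>2)"
  note sub = prox_objective_minimizer[OF f(1,2) \<open>\<gamma> > 0\<close>]
  obtain p where p: "\<And>y. ?F p \<le> ?F y"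
    using prox_objective_attains[OF fd f \<open>\<gamma> > 0\<close>] by blast
  have "q = p" if q: "\<And>y. ?F q \<le> ?F y" for q
  proof -
    obtain u v where uv: "f p = ereal u" "f q = ereal v"
      using f(1) sub(1)[of p, OF p] sub(1)[of q, OF q] unfolding proper_def by (metis ereal_cases)
    have "u + ((x - p) /\<^sub>R \<gamma>) \<bullet> (q - p) \<le> v" "v + ((x - q) /\<^sub>R \<gamma>) \<bullet> (p - q) \<le> u"
      using sub(2)[of p x q, OF p] sub(2)[of q x p, OF q] uv by simp_all
    then have "((x - p) /\<^sub>R \<gamma>) \<bullet> (q - p) + ((x - q) /\<^sub>R \<gamma>) \<bullet> (p - q) \<le> 0" by linarith
    also have "((x - p) /\<^sub>R \<gamma>) \<bullet> (q - p) + ((x - q) /\<^sub>R \<gamma>) \<bullet> (p - q) = ((q - p) \<bullet> (q - p)) / \<gamma>"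
    proof -
      have "(x - p) \<bullet> (q - p) + (x - q) \<bullet> (p - q) = (q - p) \<bullet> (q - p)"
        by (simp add: inner_diff_left inner_diff_right inner_commute)
      then show ?thesis by (simp add: divide_inverse mult.commute flip: distrib_left)
    qed
    finally have "(q - p) \<bullet> (q - p) \<le> 0" using \<open>\<gamma> > 0\<close> by (simp add: divide_le_0_iff)
    then show ?thesis by (metis inner_gt_zero_iff not_less right_minus_eq)
  qed
  then have "Prox \<gamma> f x = p"
    unfolding Prox_def is_arg_min_linorder using p by (intro the_equality) auto
  then show "f (Prox \<gamma> f x) \<noteq> \<infinity>"
    "f (Prox \<gamma> f x) + ereal (((x - Prox \<gamma> f x) /\<^sub>R \<gamma>) \<bullet> (y - Prox \<gamma> f x)) \<le> f y"
    using sub[of p, OF p] by simp_all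
qed

lemma convex_ereal_fenchel_conjugate: "convex_ereal (fenchel_conjugate f)"
  unfolding convex_ereal_def
proof (intro allI impI)
  fix p q :: 'a and t :: real assume t: "0 < t \<and> t < 1"
  show "fenchel_conjugate f ((1 - t) *\<^sub>R p + t *\<^sub>R q)
    \<le> ereal (1 - t) * fenchel_conjugate f p + ereal t * fenchel_conjugate f q"
    unfolding fenchel_conjugate_def[of f "(1 - t) *\<^sub>R p + t *\<^sub>R q"]
  proof (rule SUP_least)
    fix x
    have up: "ereal (s \<bullet> x) - f x \<le> fenchel_conjugate f s" for s
      unfolding fenchel_conjugate_def by (rule SUP_upper) simp
    \<comment> \<open>Both weights are positive, so the identity survives infinite values of
      \<open>f x\<close>.\<close>
    have "ereal (((1 - t) *\<^sub>R p + t *\<^sub>R q) \<bullet> x) - f x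
      = ereal (1 - t) * (ereal (p \<bullet> x) - f x) + ereal t * (ereal (q \<bullet> x) - f x)"
      using t by (cases "f x") (auto simp: inner_add_left algebra_simps)
    also have "\<dots> \<le> ereal (1 - t) * fenchel_conjugate f p + ereal t * fenchel_conjugate f q"
      using t by (intro add_mono ereal_mult_left_mono up) auto
    finally show "ereal (((1 - t) *\<^sub>R p + t *\<^sub>R q) \<bullet> x) - f x
      \<le> ereal (1 - t) * fenchel_conjugate f p + ereal t * fenchel_conjugate f q" .
  qed
qed

lemma lsc_fenchel_conjugate: "lsc (fenchel_conjugate f)"
proof (rule lscI_nhds)
  fix p c assume "c < fenchel_conjugate f p"
  then obtain x where x: "c < ereal (p \<bullet> x) - f x"
    unfolding fenchel_conjugate_def by (auto simp: less_SUP_iff)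
  have "((\<lambda>q. ereal (q \<bullet> x) - f x) \<longlongrightarrow> ereal (p \<bullet> x) - f x) (nhds p)"
    by (intro tendsto_diff_ereal_general tendsto_intros tendsto_const filterlim_ident) auto
  then have "eventually (\<lambda>q. c < ereal (q \<bullet> x) - f x) (nhds p)"
    using x by (intro order_tendstoD(1))
  then show "eventually (\<lambda>q. c < fenchel_conjugate f q) (nhds p)"
  proof eventually_elim
    case (elim q)
    also have "ereal (q \<bullet> x) - f x \<le> fenchel_conjugate f q"
      unfolding fenchel_conjugate_def by (rule SUP_upper) simp
    finally show ?case .
  qed
qed

text \<open>A subgradient of \<open>f\<close>, which the proximal point of \<open>f\<close> provides, lies in the domain of the
  conjugate.\<close>

lemma proper_fenchel_conjugate:
  fixes f :: "'a::real_inner \<Rightarrow> ereal"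
  assumes fd: "\<exists>B :: 'a set. finite B \<and> span B = UNIV"
    and f: "proper f" "convex_ereal f" "lsc f"
  shows "proper (fenchel_conjugate f)"
  unfolding proper_def
proof (intro conjI allI)
  obtain x0 r where x0: "f x0 = ereal r"
    using f(1) unfolding proper_def by (metis ereal_cases)
  fix p
  have "ereal (p \<bullet> x0 - r) \<le> fenchel_conjugate f p"
    unfolding fenchel_conjugate_def using x0 by (intro SUP_upper2[of x0]) auto
  then show "fenchel_conjugate f p \<noteq> -\<infinity>" by auto
next
  \<comment> \<open>Centre 0 and parameter 1 make \<open>- p\<close> the subgradient at
    \<open>p\<close>.\<close>
  define p where "p = Prox 1 f 0"
  note sub = Prox_subgradient[OF fd f zero_less_one, of 0, folded p_def]
  obtain u where u: "f p = ereal u"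
    using f(1) sub(1) unfolding proper_def by (metis ereal_cases)
  have "fenchel_conjugate f (- p) \<le> ereal ((- p) \<bullet> p - u)"
    unfolding fenchel_conjugate_def
  proof (rule SUP_least)
    fix y
    have "ereal u + ereal ((- p) \<bullet> (y - p)) \<le> f y" using sub(2)[of y] u by simp
    then show "ereal ((- p) \<bullet> y) - f y \<le> ereal ((- p) \<bullet> p - u)"
      by (cases "f y") (auto simp: inner_diff_right)
  qed
  then show "\<exists>p. fenchel_conjugate f p \<noteq> \<infinity>" by (intro exI[of _ "- p"]) auto
qed

subsection \<open>One step of the primal-dual iteration\<close>

lemma convex_gradient_ineq:
  fixes \<phi> :: "'a::real_inner \<Rightarrow> real"
  assumes "convex_on UNIV \<phi>" "GDERIV \<phi> u :> D"
  shows "\<phi> u + D \<bullet> (z - u) \<le> \<phi> z"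
proof -
  define k where "k = (\<lambda>t. \<phi> (u + t *\<^sub>R (z - u)))"
  have "convex_on UNIV k"
  proof (rule convex_onI)
    fix t r s :: real assume t: "0 < t" "t < 1"
    have "u + ((1 - t) *\<^sub>R r + t *\<^sub>R s) *\<^sub>R (z - u)
      = (1 - t) *\<^sub>R (u + r *\<^sub>R (z - u)) + t *\<^sub>R (u + s *\<^sub>R (z - u))"
      by (simp add: algebra_simps)
    then show "k ((1 - t) *\<^sub>R r + t *\<^sub>R s) \<le> (1 - t) * k r + t * k s"
      using convex_onD[OF assms(1), of t "u + r *\<^sub>R (z - u)" "u + s *\<^sub>R (z - u)"] t
      unfolding k_def by simp
  qed simp
  moreover have "(k has_field_derivative (z - u) \<bullet> D) (at 0)"
  proof -
    have "((\<lambda>t. u + t *\<^sub>R (z - u)) has_derivative (\<lambda>t. t *\<^sub>R (z - u))) (at 0)"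
      by (auto intro!: derivative_eq_intros)
    moreover have "(\<phi> has_derivative (\<lambda>h. h \<bullet> D)) (at (u + 0 *\<^sub>R (z - u)))"
      using assms(2) by (simp add: gderiv_def)
    ultimately have "(k has_derivative (\<lambda>t. (t *\<^sub>R (z - u)) \<bullet> D)) (at 0)"
      unfolding k_def by (rule has_derivative_compose)
    then show ?thesis
      by (simp add: has_field_derivative_def mult.commute[of _ "(z - u) \<bullet> D"])
  qed
  ultimately have "k 1 - k 0 \<ge> ((z - u) \<bullet> D) * (1 - 0)"
    using convex_on_imp_above_tangent[of UNIV k 0 1] by simp
  then show ?thesis by (simp add: k_def inner_commute)
qed

text \<open>Convexity replaces integration along the segment: the gradient inequality is used at
  \<open>z\<close>, and exchanging \<open>\<phi>' z\<close> for \<open>\<phi>' u\<close> costs the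
  Lipschitz bound. The resulting constant \<open>L\<close> instead of \<open>L / 2\<close> still
  suffices for step sizes below \<beta>.\<close>

lemma convex_lipschitz_gradient_upper:
  fixes \<phi> :: "'a::real_inner \<Rightarrow> real"
  assumes "convex_on UNIV \<phi>" "\<And>z. GDERIV \<phi> z :> \<phi>' z" "lipschitz_on L UNIV \<phi>'"
  shows "\<phi> z \<le> \<phi> u + \<phi>' u \<bullet> (z - u) + L * (norm (z - u))\<^sup>2"
proof -
  have "(\<phi>' z - \<phi>' u) \<bullet> (z - u) \<le> norm (\<phi>' z - \<phi>' u) * norm (z - u)"
    by (rule norm_cauchy_schwarz)
  also have "\<dots> \<le> L * norm (z - u) * norm (z - u)"
    using lipschitz_onD[OF assms(3), of z u] by (intro mult_right_mono) (auto simp: dist_norm)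
  finally show ?thesis
    using convex_gradient_ineq[OF assms(1,2), of z u]
    by (simp add: power2_eq_square inner_diff_left inner_diff_right)
qed

text \<open>The coupling term is bilinear, so linearising it costs only a quadratic error.\<close>

lemma coupled_lower_bound:
  fixes g :: "'a::real_inner \<Rightarrow> ereal" and H :: "'b::real_inner \<Rightarrow> ereal"
  assumes g: "\<And>z. ereal (r + \<xi> \<bullet> (z - u)) \<le> g z"
    and H: "\<And>z. ereal (s + \<zeta> \<bullet> (z - v)) \<le> H z"
    and \<phi>: "\<And>z. \<phi> u + D \<bullet> (z - u) \<le> \<phi> z"
    and K: "linear K" "\<And>z. norm (K z) \<le> C * norm z" and C: "C \<ge> 0"
    and A: "\<And>z w. z \<bullet> A w = K z \<bullet> w"
  shows "ereal (r + \<phi> u + s - v \<bullet> K u + (\<xi> + D - A v, \<zeta> - K u) \<bullet> (z - (u, v))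
      - C * (norm (z - (u, v)))\<^sup>2)
    \<le> g (fst z) + ereal (\<phi> (fst z)) + H (snd z) - ereal (snd z \<bullet> K (fst z))"
proof -
  obtain a b where z: "z = (a, b)" by fastforce
  let ?d = "norm (z - (u, v))"
  have "norm (a - u) \<le> ?d" "norm (b - v) \<le> ?d"
    using norm_fst_le[of "a - u" "b - v"] norm_snd_le[of "b - v" "a - u"] by (simp_all add: z)
  \<comment> \<open>This product is the exact error of linearising the coupling at
    \<open>(u, v)\<close>.\<close>
  have "(b - v) \<bullet> K (a - u) \<le> norm (b - v) * norm (K (a - u))"
    by (rule norm_cauchy_schwarz)
  also have "\<dots> \<le> ?d * (C * ?d)"
    using \<open>norm (a - u) \<le> ?d\<close> \<open>norm (b - v) \<le> ?d\<close> K(2)[of "a - u"] C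
    by (intro mult_mono) (auto intro: order_trans mult_left_mono)
  finally have "(b - v) \<bullet> K (a - u) \<le> C * ?d\<^sup>2"
    by (simp add: power2_eq_square mult_ac)
  moreover have "(b - v) \<bullet> K (a - u) = b \<bullet> K a - b \<bullet> K u - v \<bullet> K a + v \<bullet> K u"
    using K(1) by (simp add: linear_diff inner_diff_left inner_diff_right)
  moreover have "A v \<bullet> (a - u) = v \<bullet> K a - v \<bullet> K u"
    using A[of "a - u" v] K(1) by (simp add: linear_diff inner_diff_left inner_diff_right inner_commute)
  moreover have "K u \<bullet> (b - v) = b \<bullet> K u - v \<bullet> K u"
    by (simp add: inner_diff_right inner_commute)
  ultimately have "r + \<phi> u + s - v \<bullet> K u + (\<xi> + D - A v, \<zeta> - K u) \<bullet> (z - (u, v)) - C * ?d\<^sup>2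
    \<le> (r + \<xi> \<bullet> (a - u)) + (\<phi> u + D \<bullet> (a - u)) + (s + \<zeta> \<bullet> (b - v)) - b \<bullet> K a"
    by (simp add: z inner_add_left inner_diff_left[of _ _ "a - u"] inner_diff_left[of _ _ "b - v"])
  also have "\<dots> \<le> (r + \<xi> \<bullet> (a - u)) + \<phi> a + (s + \<zeta> \<bullet> (b - v)) - b \<bullet> K a"
    using \<phi>[of a] by simp
  finally have "ereal (r + \<phi> u + s - v \<bullet> K u + (\<xi> + D - A v, \<zeta> - K u) \<bullet> (z - (u, v)) - C * ?d\<^sup>2)
    \<le> ereal (r + \<xi> \<bullet> (a - u)) + ereal (\<phi> a) + ereal (s + \<zeta> \<bullet> (b - v)) - ereal (b \<bullet> K a)"
    by simp
  also have "\<dots> \<le> g a + ereal (\<phi> a) + H b - ereal (b \<bullet> K a)"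
    by (intro ereal_minus_mono add_mono g H order_refl)
  finally show ?thesis by (simp add: z)
qed

text \<open>Both subgradient inequalities are tested at the old iterate, which yields the full
  \<open>1 / \<gamma>\<close> and \<open>1 / \<mu>\<close>, twice what comparing proximal objectives
  would give. The primal step contributes \<open>y \<bullet> K x - y \<bullet> K x'\<close> and the
  dual step \<open>y \<bullet> K x' - y' \<bullet> K x'\<close>; the mixed term cancels because the
  dual step already uses \<open>x'\<close>.\<close>

lemma primal_dual_step_descent:
  fixes x x' :: "'a::real_inner" and y y' :: "'b::real_inner"
  assumes g: "g' + ((x + \<gamma> *\<^sub>R A y - \<gamma> *\<^sub>R D - x') /\<^sub>R \<gamma>) \<bullet> (x - x') \<le> g0"
    and H: "h' + ((y + \<mu> *\<^sub>R K x' - y') /\<^sub>R \<mu>) \<bullet> (y - y') \<le> h0"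
    and \<phi>: "\<phi>1 \<le> \<phi>0 + D \<bullet> (x' - x) + L * (norm (x' - x))\<^sup>2"
    and A: "\<And>z w. z \<bullet> A w = K z \<bullet> w" and "linear K" and "\<gamma> > 0" "\<mu> > 0"
  shows "g' + \<phi>1 + h' - y' \<bullet> K x' + (1 / \<gamma> - L) * (norm (x' - x))\<^sup>2 + 1 / \<mu> * (norm (y' - y))\<^sup>2
    \<le> g0 + \<phi>0 + h0 - y \<bullet> K x"
proof -
  have "((x + \<gamma> *\<^sub>R A y - \<gamma> *\<^sub>R D - x') /\<^sub>R \<gamma>) = (1 / \<gamma>) *\<^sub>R (x - x') + A y - D"
    using \<open>\<gamma> > 0\<close> by (simp add: algebra_simps divide_inverse)
  then have "((x + \<gamma> *\<^sub>R A y - \<gamma> *\<^sub>R D - x') /\<^sub>R \<gamma>) \<bullet> (x - x')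
      = 1 / \<gamma> * ((x - x') \<bullet> (x - x')) + A y \<bullet> (x - x') - D \<bullet> (x - x')"
    by (simp only: inner_add_left inner_diff_left[of _ _ "x - x'"] inner_scaleR_left)
  moreover have "A y \<bullet> (x - x') = y \<bullet> K x - y \<bullet> K x'"
    using A[of "x - x'" y] \<open>linear K\<close> by (simp add: linear_diff inner_diff_right inner_commute)
  moreover have "(x - x') \<bullet> (x - x') = (norm (x' - x))\<^sup>2"
    by (simp only: norm_minus_commute[of x' x] power2_norm_eq_inner)
  ultimately have 1: "((x + \<gamma> *\<^sub>R A y - \<gamma> *\<^sub>R D - x') /\<^sub>R \<gamma>) \<bullet> (x - x')
      = 1 / \<gamma> * (norm (x' - x))\<^sup>2 + (y \<bullet> K x - y \<bullet> K x') + D \<bullet> (x' - x)"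
    by (simp add: inner_diff_right)
  have "((y + \<mu> *\<^sub>R K x' - y') /\<^sub>R \<mu>) = (1 / \<mu>) *\<^sub>R (y - y') + K x'"
    using \<open>\<mu> > 0\<close> by (simp add: algebra_simps divide_inverse)
  then have "((y + \<mu> *\<^sub>R K x' - y') /\<^sub>R \<mu>) \<bullet> (y - y')
      = 1 / \<mu> * ((y - y') \<bullet> (y - y')) + K x' \<bullet> (y - y')"
    by (simp only: inner_add_left inner_scaleR_left)
  moreover have "(y - y') \<bullet> (y - y') = (norm (y' - y))\<^sup>2"
    by (simp only: norm_minus_commute[of y' y] power2_norm_eq_inner)
  ultimately have 2: "((y + \<mu> *\<^sub>R K x' - y') /\<^sub>R \<mu>) \<bullet> (y - y')
      = 1 / \<mu> * (norm (y' - y))\<^sup>2 + (y \<bullet> K x' - y' \<bullet> K x')"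
    by (simp add: inner_diff_right inner_commute)
  show ?thesis using g H \<phi> unfolding 1 2 by (simp add: algebra_simps)
qed

lemma INF_ereal_pos_lower_bound:
  assumes "0 < (INF n. ereal (s n))"
  obtains e where "0 < e" "\<And>n. e \<le> s n"
proof -
  obtain e where e: "0 < ereal e" "ereal e < (INF n. ereal (s n))"
    using ereal_dense2[OF assms] by blast
  have "ereal e \<le> ereal (s n)" for n
    using e(2) INF_lower[of n UNIV "\<lambda>n. ereal (s n)"] by (metis UNIV_I less_imp_le order_trans)
  then show thesis using that e(1) by simp
qed

lemma SUP_ereal_upper_bound:
  assumes "(SUP n. ereal (s n)) < B"
  obtains e where "ereal e < B" "\<And>n. s n \<le> e"
proof -
  obtain e where e: "(SUP n. ereal (s n)) < ereal e" "ereal e < B"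
    using ereal_dense2[OF assms] by blast
  have "ereal (s n) \<le> ereal e" for n
    using e(1) SUP_upper[of n UNIV "\<lambda>n. ereal (s n)"] by (metis UNIV_I less_imp_le order_trans)
  then show thesis using that e(2) by simp
qed

text \<open>The subgradient at the new iterate involves \<open>D'\<close> and \<open>A y'\<close>,
  whereas the proximal step used \<open>D\<close> and \<open>A y\<close>. The residual consists of
  these two differences and the proximal displacement.\<close>

lemma primal_residual_bound:
  fixes x x' :: "'a::real_inner" and y y' :: "'b::real_inner"
  assumes A: "\<And>z w. z \<bullet> A w = K z \<bullet> w" and K: "\<And>z. norm (K z) \<le> C * norm z" and "C \<ge> 0"
    and D: "norm (D' - D) \<le> L * norm (x' - x)" and "\<gamma> > 0"
  shows "norm ((x + \<gamma> *\<^sub>R A y - \<gamma> *\<^sub>R D - x') /\<^sub>R \<gamma> + D' - A y')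
    \<le> 1 / \<gamma> * norm (x' - x) + C * norm (y' - y) + L * norm (x' - x)"
proof -
  define v where "v = A y - A y'"
  have v: "norm v \<le> C * norm (y' - y)"
  proof (cases "v = 0")
    case False
    \<comment> \<open>\<open>A\<close> inherits the constant of \<open>K\<close>: pair
      \<open>v\<close> with itself, move \<open>A\<close> across, divide by
      \<open>norm v\<close>.\<close>
    have "norm v * norm v = v \<bullet> v" by (simp add: dot_square_norm power2_eq_square)
    also have "\<dots> = K v \<bullet> (y - y')"
      using A[of v y] A[of v y'] by (simp add: v_def inner_diff_right)
    also have "\<dots> \<le> norm (K v) * norm (y - y')" by (rule norm_cauchy_schwarz)
    also have "\<dots> \<le> C * norm v * norm (y - y')"
      by (intro mult_right_mono K) auto
    also have "\<dots> = C * norm (y' - y) * norm v"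
      by (simp add: norm_minus_commute)
    finally show ?thesis using False by simp
  qed (use \<open>C \<ge> 0\<close> in simp)
  have "(x + \<gamma> *\<^sub>R A y - \<gamma> *\<^sub>R D - x') /\<^sub>R \<gamma> + D' - A y' = (1 / \<gamma>) *\<^sub>R (x - x') + v + (D' - D)"
    using \<open>\<gamma> > 0\<close> by (simp add: v_def algebra_simps divide_inverse)
  also have "norm \<dots> \<le> norm ((1 / \<gamma>) *\<^sub>R (x - x')) + norm v + norm (D' - D)"
    by (intro norm_triangle_le add_mono order_refl norm_triangle_ineq)
  also have "norm ((1 / \<gamma>) *\<^sub>R (x - x')) = 1 / \<gamma> * norm (x' - x)"
    using \<open>\<gamma> > 0\<close> by (simp add: norm_minus_commute)
  finally show ?thesis using v D by linarith
qed

subsection \<open>Rates from a KL inequality for real sequences\<close>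

lemma eventually_bound_imp_bound:
  fixes a b :: "nat \<Rightarrow> real"
  assumes "\<And>n. n \<ge> k \<Longrightarrow> b n > 0" and "eventually (\<lambda>n. a n \<le> C * b n) sequentially"
  obtains c where "c > 0" "\<And>n. n \<ge> k \<Longrightarrow> a n \<le> c * b n"
proof -
  obtain N where N: "\<And>n. n \<ge> N \<Longrightarrow> a n \<le> C * b n"
    using assms(2) by (auto simp: eventually_sequentially)
  \<comment> \<open>The sum absorbs the finitely many early indices. It may include indices below
    \<open>k\<close>, whose nonnegative terms only enlarge \<open>c\<close>.\<close>
  define c where "c = 1 + \<bar>C\<bar> + (\<Sum>i<N. \<bar>a i / b i\<bar>)"
  have s0: "(\<Sum>i<N. \<bar>a i / b i\<bar>) \<ge> 0" by (simp add: sum_nonneg)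
  show thesis
  proof
    show "c > 0" using s0 by (simp add: c_def)
    fix n assume "n \<ge> k"
    then have b: "b n > 0" by (rule assms)
    show "a n \<le> c * b n"
    proof (cases "n \<ge> N")
      case True
      have "C * b n \<le> c * b n"
        using b s0 by (intro mult_right_mono) (auto simp: c_def)
      then show ?thesis using N[OF True] by linarith
    next
      case False
      then have "\<bar>a n / b n\<bar> \<le> (\<Sum>i<N. \<bar>a i / b i\<bar>)"
        by (intro member_le_sum) auto
      then have "a n / b n \<le> c" unfolding c_def by linarith
      then show ?thesis using b by (simp add: divide_le_eq)
    qed
  qed
qed

text \<open>The tangent inequality of a concave power is Young's inequality with weights
  \<open>1 - \<theta>\<close> and \<open>\<theta>\<close>, multiplied by
  \<open>r powr (-\<theta>)\<close>.\<close>

lemma powr_tangent_above: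
  fixes r s \<theta> :: real
  assumes "0 < r" "0 < s" "0 \<le> \<theta>" "\<theta> \<le> 1"
  shows "(1 - \<theta>) * r powr (-\<theta>) * (r - s) \<le> r powr (1 - \<theta>) - s powr (1 - \<theta>)"
proof -
  have "s powr (1 - \<theta>) * r powr \<theta> \<le> (1 - \<theta>) * s + \<theta> * r"
    using assms by (intro Youngs_inequality_0) auto
  then have "r powr (-\<theta>) * (s powr (1 - \<theta>) * r powr \<theta>) \<le> r powr (-\<theta>) * ((1 - \<theta>) * s + \<theta> * r)"
    by (intro mult_left_mono) auto
  moreover have "r powr (-\<theta>) * r powr \<theta> = 1"
    using assms by (simp add: powr_minus)
  then have "r powr (-\<theta>) * (s powr (1 - \<theta>) * r powr \<theta>) = s powr (1 - \<theta>)"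
    by (metis mult.left_commute mult.right_neutral)
  moreover have "r powr (1 - \<theta>) = r powr (-\<theta>) * r"
    using assms by (metis powr_add powr_one less_imp_le diff_conv_add_uminus add.commute)
  ultimately show ?thesis by argo
qed

text \<open>The tangent inequality of a convex power; after scaling by \<open>r\<close> it follows
  from \<open>ln t \<le> t - 1\<close> and \<open>exp t \<ge> 1 + t\<close>.\<close>

lemma powr_neg_tangent_below:
  fixes r s \<alpha> :: real
  assumes "0 < r" "0 < s" "0 \<le> \<alpha>"
  shows "\<alpha> * r powr (-\<alpha> - 1) * (r - s) \<le> s powr (-\<alpha>) - r powr (-\<alpha>)"
proof -
  have "1 + \<alpha> * (1 - s / r) \<le> 1 - \<alpha> * ln (s / r)"
    using mult_left_mono[OF ln_le_minus_one[of "s / r"] assms(3)] assms by (simp add: right_diff_distrib)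
  also have "\<dots> \<le> (s / r) powr (-\<alpha>)"
    using assms exp_ge_add_one_self[of "- \<alpha> * ln (s / r)"] by (simp add: powr_def)
  finally have "r powr (-\<alpha>) * (1 + \<alpha> * (1 - s / r)) \<le> r powr (-\<alpha>) * (s / r) powr (-\<alpha>)"
    by (intro mult_left_mono) auto
  also have "\<dots> = s powr (-\<alpha>)"
    using assms by (simp add: powr_divide)
  finally have *: "r powr (-\<alpha>) + r powr (-\<alpha>) * (\<alpha> * (1 - s / r)) \<le> s powr (-\<alpha>)"
    by (simp add: algebra_simps)
  have "r powr (-\<alpha>) = r powr (-\<alpha> - 1) * r"
    using assms by (simp add: powr_diff)
  then have "r powr (-\<alpha>) * (\<alpha> * (1 - s / r)) = \<alpha> * r powr (-\<alpha> - 1) * (r - s)"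
    using assms by (simp add: field_simps)
  with * show ?thesis by simp
qed

text \<open>\<open>r\<close> is the gap of the objective value and \<open>d\<close> the length of the last step, both shifted to an
  index from which the KL inequality holds and the gap is at most \<open>1\<close>.\<close>

locale KL_descent =
  fixes r :: "nat \<Rightarrow> real" and d :: "nat \<Rightarrow> real" and w :: "nat \<Rightarrow> 'a::real_normed_vector"
    and wlim :: 'a and a C \<theta> :: real
  assumes r_pos: "\<And>n. r n > 0" and r_le_1: "\<And>n. r n \<le> 1" and a: "a > 0" and C: "C > 0"
    and theta: "0 \<le> \<theta>" "\<theta> < 1"
    and descent: "\<And>n. a * (d (Suc n))\<^sup>2 \<le> r n - r (Suc n)"
    and KL: "\<And>n. r n powr \<theta> \<le> C * d n"
    and step: "\<And>n. norm (w (Suc n) - w n) \<le> d (Suc n)"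
    and w_lim: "w \<longlonglongrightarrow> wlim"
begin

text \<open>A zero step would violate KL while the gap is positive; this permits division by
  \<open>d\<close>.\<close>

lemma d_pos: "d n > 0"
proof -
  have "0 < C * d n" using KL[of n] r_pos[of n] by (smt (verit) powr_gt_zero)
  then show ?thesis using C by (simp add: zero_less_mult_iff)
qed

lemma r_antimono: "r (Suc n) \<le> r n"
  using descent[of n] a by (smt (verit) mult_nonneg_nonneg zero_le_power2)

text \<open>KL at \<open>Suc n\<close> and descent from \<open>n\<close> to \<open>Suc n\<close>
  involve the same step length; eliminating it leaves a recursion for \<open>r\<close> alone, which
  drives both decay estimates.\<close>

lemma r_powr_le: "r (Suc n) powr (2 * \<theta>) \<le> C\<^sup>2 / a * (r n - r (Suc n))"
proof -
  have "r (Suc n) powr (2 * \<theta>) = (r (Suc n) powr \<theta>)\<^sup>2"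
    using r_pos[of "Suc n"] by (simp add: power2_eq_square flip: powr_add)
  also have "\<dots> \<le> (C * d (Suc n))\<^sup>2"
    by (intro power_mono KL) auto
  also have "\<dots> = C\<^sup>2 / a * (a * (d (Suc n))\<^sup>2)"
    using a by (simp add: power_mult_distrib)
  also have "\<dots> \<le> C\<^sup>2 / a * (r n - r (Suc n))"
    using a by (intro mult_left_mono descent) auto
  finally show ?thesis .
qed

text \<open>Descent, KL and concavity bound the square of \<open>d (Suc k)\<close> by
  \<open>d k\<close> times a telescoping difference, and the inequality of the means makes this
  linear. On summation the factor 2 on the left absorbs the steps on the right, so the path after
  \<open>n\<close> has length at most \<open>d n\<close> plus the telescoped total.\<close>

lemma tail_bound:
  "norm (w n - wlim) \<le> d n + C / (a * (1 - \<theta>)) * r n powr (1 - \<theta>)"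
proof -
  \<comment> \<open>Multiplication by \<open>c * d k\<close> cancels all constants in the tangent
    estimate below.\<close>
  define c where "c = C / (a * (1 - \<theta>))"
  have c: "c > 0" using a C theta by (simp add: c_def)
  let ?p = "\<lambda>k. r k powr (1 - \<theta>)"
  have step2: "2 * d (Suc k) \<le> d k + c * (?p k - ?p (Suc k))" for k
  proof -
    have "1 / (C * d k) \<le> r k powr (-\<theta>)"
      using KL[of k] r_pos[of k] C d_pos[of k] by (simp add: powr_minus field_simps)
    then have "(1 - \<theta>) * (1 / (C * d k)) * (a * (d (Suc k))\<^sup>2)
        \<le> (1 - \<theta>) * r k powr (-\<theta>) * (r k - r (Suc k))"
      using theta descent[of k] a C d_pos[of k] by (intro mult_mono mult_left_mono) auto
    also have "\<dots> \<le> ?p k - ?p (Suc k)"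
      using theta r_pos by (intro powr_tangent_above) auto
    finally have "c * d k * ((1 - \<theta>) * (1 / (C * d k)) * (a * (d (Suc k))\<^sup>2)) \<le> c * d k * (?p k - ?p (Suc k))"
      using c d_pos[of k] by (intro mult_left_mono) auto
    moreover have "c * d k * ((1 - \<theta>) * (1 / (C * d k)) * (a * (d (Suc k))\<^sup>2)) = (d (Suc k))\<^sup>2"
      using a C theta d_pos[of k] by (simp add: c_def)
    moreover define q where "q = c * (?p k - ?p (Suc k))"
    moreover have "c * d k * (?p k - ?p (Suc k)) = d k * q"
      by (simp add: q_def)
    ultimately have *: "(d (Suc k))\<^sup>2 \<le> d k * q"
      by argo
    have "0 < d k * q" using * d_pos[of "Suc k"] by (smt (verit) zero_less_power)
    then have q: "q > 0" using d_pos[of k] by (simp add: zero_less_mult_iff)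
    have "(2 * d (Suc k))\<^sup>2 \<le> 4 * (d k * q)" using * by (simp add: power_mult_distrib)
    also have "\<dots> = (d k + q)\<^sup>2 - (d k - q)\<^sup>2" by (simp add: power2_eq_square algebra_simps)
    also have "\<dots> \<le> (d k + q)\<^sup>2" by simp
    finally have "2 * d (Suc k) \<le> d k + q"
      by (rule power2_le_imp_le) (use q d_pos[of k] in simp)
    then show ?thesis unfolding q_def .
  qed
  have sum_bound: "2 * (\<Sum>k<m. d (Suc (n + k))) \<le> (\<Sum>k<m. d (n + k)) + c * (?p n - ?p (n + m))" for m
  proof (induction m)
    case (Suc m)
    show ?case using Suc.IH step2[of "n + m"] by (simp add: right_diff_distrib)
  qed simp
  have "norm (w n - w (n + m)) \<le> d n + c * ?p n" for m
  proof -
    have shift: "(\<Sum>k<m. d (n + k)) \<le> d n + (\<Sum>k<m. d (Suc (n + k)))"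
    proof -
      have "(\<Sum>k<m. d (n + k)) \<le> (\<Sum>k<Suc m. d (n + k))" using d_pos[of "n + m"] by simp
      also have "\<dots> = d n + (\<Sum>k<m. d (Suc (n + k)))" by (subst sum.lessThan_Suc_shift) simp
      finally show ?thesis .
    qed
    have "norm (w n - w (n + m)) \<le> (\<Sum>k<m. d (Suc (n + k)))"
    proof (induction m)
      case (Suc m)
      have "norm (w n - w (n + Suc m)) \<le> norm (w n - w (n + m)) + norm (w (Suc (n + m)) - w (n + m))"
        using norm_triangle_ineq4[of "w n - w (n + m)" "w (Suc (n + m)) - w (n + m)"] by simp
      also have "\<dots> \<le> (\<Sum>k<m. d (Suc (n + k))) + d (Suc (n + m))"
        by (intro add_mono Suc.IH step)
      finally show ?case by simp
    qed simp
    moreover have "c * ?p (n + m) \<ge> 0" using c by simp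
    ultimately show ?thesis
      using sum_bound[of m] shift by (simp add: right_diff_distrib)
  qed
  moreover have "(\<lambda>m. norm (w n - w (n + m))) \<longlonglongrightarrow> norm (w n - wlim)"
    using LIMSEQ_ignore_initial_segment[OF w_lim, of n]
    by (intro tendsto_intros) (simp add: add.commute)
  ultimately show ?thesis
    unfolding c_def[symmetric] by (intro LIMSEQ_le_const2) auto
qed

lemma d_bound: "d (Suc n) \<le> sqrt (r n / a)"
proof -
  have "(d (Suc n))\<^sup>2 \<le> r n / a"
    using descent[of n] r_pos[of "Suc n"] a by (simp add: pos_le_divide_eq mult.commute)
  then show ?thesis by (rule real_le_rsqrt)
qed

text \<open>For exponent 0 the KL inequality bounds the steps away from 0, so every step would lower
  the gap by a fixed amount. Hence a gap that stays positive is impossible.\<close>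

lemma finite_termination:
  assumes "\<theta> = 0" "r \<longlonglongrightarrow> 0"
  shows False
proof -
  have "1 / C \<le> d n" for n
    using KL[of n] r_pos[of n] C \<open>\<theta> = 0\<close> by (simp add: field_simps)
  then have "a * (1 / C)\<^sup>2 \<le> r n" for n
    using descent[of n] r_pos[of "Suc n"] a C
    by (smt (verit) mult_left_mono power_mono zero_le_divide_1_iff)
  then have "a * (1 / C)\<^sup>2 \<le> 0"
    using LIMSEQ_le_const[OF assms(2)] by blast
  moreover have "a * (1 / C)\<^sup>2 > 0" using a C by simp
  ultimately show False by linarith
qed

text \<open>\<open>d (Suc n)\<close> is controlled by the gap at \<open>n\<close>, which explains
  the index shift. As the gap is at most 1, both exponents \<open>1/2\<close> and
  \<open>1 - \<theta>\<close> can be lowered to a common \<kappa>.\<close>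

lemma tail_bound_powr:
  assumes "\<kappa> \<le> 1/2" "\<kappa> \<le> 1 - \<theta>"
  shows "norm (w (Suc n) - wlim) \<le> (sqrt (1 / a) + C / (a * (1 - \<theta>))) * r n powr \<kappa>"
proof -
  have "d (Suc n) \<le> sqrt (1 / a) * sqrt (r n)"
    using d_bound[of n] by (simp add: real_sqrt_divide)
  also have "sqrt (r n) = r n powr (1/2)"
    using r_pos[of n] by (simp add: powr_half_sqrt)
  also have "\<dots> \<le> r n powr \<kappa>"
    using assms r_pos[of n] r_le_1[of n] by (intro powr_mono') auto
  finally have 1: "d (Suc n) \<le> sqrt (1 / a) * r n powr \<kappa>"
    using a by (simp add: mult_left_mono)
  have "r (Suc n) powr (1 - \<theta>) \<le> r n powr (1 - \<theta>)"
    using r_antimono[of n] r_pos[of "Suc n"] theta by (intro powr_mono2) auto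
  also have "\<dots> \<le> r n powr \<kappa>"
    using assms r_pos[of n] r_le_1[of n] by (intro powr_mono') auto
  finally have 2: "C / (a * (1 - \<theta>)) * r (Suc n) powr (1 - \<theta>) \<le> C / (a * (1 - \<theta>)) * r n powr \<kappa>"
    using a C theta by (intro mult_left_mono) auto
  show ?thesis using tail_bound[of "Suc n"] 1 2 by (simp add: distrib_right)
qed

lemma geometric_rate:
  assumes "\<theta> \<le> 1/2"
  obtains c q where "0 < q" "q < 1" "\<And>n. norm (w (Suc n) - wlim) \<le> c * q ^ n"
proof -
  define D where "D = C\<^sup>2 / a"
  have D: "D > 0" using a C by (simp add: D_def)
  \<comment> \<open>Solving \<open>r (Suc n) \<le> D * (r n - r (Suc n))\<close> for
    \<open>r (Suc n)\<close> gives this factor.\<close>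
  define \<rho> where "\<rho> = D / (1 + D)"
  have rho: "0 < \<rho>" "\<rho> < 1" using D by (auto simp: \<rho>_def)
  have "r (Suc n) \<le> \<rho> * r n" for n
  proof -
    have "r (Suc n) powr 1 \<le> r (Suc n) powr (2 * \<theta>)"
      using assms r_pos[of "Suc n"] r_le_1[of "Suc n"] by (intro powr_mono') auto
    then have "r (Suc n) \<le> D * (r n - r (Suc n))"
      using r_powr_le[of n] r_pos[of "Suc n"] by (simp add: D_def)
    then show ?thesis using D by (simp add: \<rho>_def field_simps)
  qed
  note contr = this
  have geo: "r n \<le> \<rho> ^ n" for n
  proof (induction n)
    case (Suc n)
    have "\<rho> * r n \<le> \<rho> * \<rho> ^ n" using Suc rho by (intro mult_left_mono) auto
    then show ?case using contr[of n] by simp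
  qed (simp add: r_le_1)
  define c where "c = sqrt (1 / a) + C / (a * (1 - \<theta>))"
  have c: "c \<ge> 0" using a C theta by (simp add: c_def)
  show thesis
  proof (rule that[of "sqrt \<rho>" c])
    fix n
    have "norm (w (Suc n) - wlim) \<le> c * r n powr (1/2)"
      using tail_bound_powr[of "1/2" n] assms by (simp add: c_def)
    also have "r n powr (1/2) = sqrt (r n)"
      using r_pos[of n] by (simp add: powr_half_sqrt)
    also have "c * sqrt (r n) \<le> c * sqrt \<rho> ^ n"
      using geo[of n] c by (intro mult_left_mono) (simp_all flip: real_sqrt_power)
    finally show "norm (w (Suc n) - wlim) \<le> c * sqrt \<rho> ^ n" .
  qed (use rho in auto)
qed

lemma sublinear_rate:
  assumes "1/2 < \<theta>"
  obtains c where "c \<ge> 0"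
    "\<And>n. n \<ge> 1 \<Longrightarrow> norm (w (Suc n) - wlim) \<le> c * real n powr (- ((1 - \<theta>) / (2 * \<theta> - 1)))"
proof -
  define \<alpha> where "\<alpha> = 2 * \<theta> - 1"
  have al: "\<alpha> > 0" using assms by (simp add: \<alpha>_def)
  define D where "D = C\<^sup>2 / a"
  have D: "D > 0" using a C by (simp add: D_def)
  \<comment> \<open>Convexity calls for a power of \<open>r n\<close>, while the recursion offers
    one of \<open>r (Suc n)\<close>. If the gap does not halve, they agree up to
    \<open>2 powr (2 * \<theta>)\<close>, giving the second entry; if it more than halves,
    \<open>r powr (-\<alpha>)\<close> grows by at least the factor \<open>2 powr \<alpha>\<close>,
    giving the first.\<close>
  define \<delta> where "\<delta> = min (2 powr \<alpha> - 1) (\<alpha> / (2 powr (2 * \<theta>) * D))"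
  have delta: "\<delta> > 0" using al D by (simp add: \<delta>_def)
  have incr: "\<delta> \<le> r (Suc n) powr (-\<alpha>) - r n powr (-\<alpha>)" for n
  proof (cases "r (Suc n) < r n / 2")
    case True
    have "(r n / 2) powr (-\<alpha>) \<le> r (Suc n) powr (-\<alpha>)"
      using True r_pos[of "Suc n"] al by (intro powr_mono2') auto
    then have "2 powr \<alpha> * r n powr (-\<alpha>) \<le> r (Suc n) powr (-\<alpha>)"
      using r_pos[of n] by (simp add: powr_divide powr_minus field_simps)
    moreover have "1 * (2 powr \<alpha> - 1) \<le> r n powr (-\<alpha>) * (2 powr \<alpha> - 1)"
    proof (rule mult_right_mono)
      have "r n powr \<alpha> \<le> 1" using r_pos[of n] r_le_1[of n] al by (intro powr_le1) auto
      then show "1 \<le> r n powr (-\<alpha>)" using r_pos[of n] by (simp add: powr_minus one_le_inverse)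
    qed (use al in \<open>simp add: ge_one_powr_ge_zero\<close>)
    ultimately show ?thesis by (simp add: \<delta>_def min_def algebra_simps)
  next
    case False
    have "(r n / 2) powr (2 * \<theta>) \<le> r (Suc n) powr (2 * \<theta>)"
      using False r_pos[of n] theta by (intro powr_mono2) auto
    also have "\<dots> \<le> D * (r n - r (Suc n))" using r_powr_le[of n] by (simp add: D_def)
    finally have "r n powr (2 * \<theta>) / (2 powr (2 * \<theta>) * D) \<le> r n - r (Suc n)"
      using D r_pos[of n] by (simp add: powr_divide field_simps)
    then have "\<alpha> * r n powr (-\<alpha> - 1) * (r n powr (2 * \<theta>) / (2 powr (2 * \<theta>) * D))
        \<le> \<alpha> * r n powr (-\<alpha> - 1) * (r n - r (Suc n))"
      using al by (intro mult_left_mono) auto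
    also have "\<dots> \<le> r (Suc n) powr (-\<alpha>) - r n powr (-\<alpha>)"
      using al r_pos by (intro powr_neg_tangent_below) auto
    also have "\<alpha> * r n powr (-\<alpha> - 1) * (r n powr (2 * \<theta>) / (2 powr (2 * \<theta>) * D))
        = \<alpha> * (r n powr (-\<alpha> - 1) * r n powr (2 * \<theta>)) / (2 powr (2 * \<theta>) * D)" by simp
    also have "r n powr (-\<alpha> - 1) * r n powr (2 * \<theta>) = 1"
      using r_pos[of n] by (simp add: \<alpha>_def flip: powr_add)
    finally show ?thesis by (simp add: \<delta>_def)
  qed
  have lower: "\<delta> * real n \<le> r n powr (-\<alpha>)" for n
  proof (induction n)
    case (Suc n)
    then show ?case using incr[of n] by (simp add: algebra_simps)
  qed simp
  define c where "c = sqrt (1 / a) + C / (a * (1 - \<theta>))"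
  have c: "c \<ge> 0" using a C theta by (simp add: c_def)
  define \<rho> where "\<rho> = (1 - \<theta>) / (2 * \<theta> - 1)"
  have rho: "\<rho> \<ge> 0" using theta assms by (simp add: \<rho>_def)
  show thesis
  proof (rule that[of "c * \<delta> powr (-\<rho>)", folded \<rho>_def])
    fix n :: nat assume n: "n \<ge> 1"
    have "norm (w (Suc n) - wlim) \<le> c * r n powr (1 - \<theta>)"
      using tail_bound_powr[of "1 - \<theta>" n] assms by (simp add: c_def)
    \<comment> \<open>The outer exponent is nonpositive, so the lower bound on
      \<open>r n powr (-\<alpha>)\<close> becomes an upper bound.\<close>
    also have "1 - \<theta> = (-\<alpha>) * (-\<rho>)" using al by (simp add: \<rho>_def flip: \<alpha>_def)
    also have "r n powr ((-\<alpha>) * (-\<rho>)) = (r n powr (-\<alpha>)) powr (-\<rho>)"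
      by (simp add: powr_powr)
    also have "\<dots> \<le> (\<delta> * real n) powr (-\<rho>)"
      using lower[of n] delta n rho by (intro powr_mono2') auto
    also have "\<dots> = \<delta> powr (-\<rho>) * real n powr (-\<rho>)"
      using delta by (simp add: powr_mult)
    finally show "norm (w (Suc n) - wlim) \<le> c * \<delta> powr (-\<rho>) * real n powr (-\<rho>)"
      using c by (simp add: mult_left_mono mult.assoc)
  qed (use c in simp)
qed

end

subsection \<open>Descent schemes for KL functions\<close>

text \<open>Divided by \<open>norm (z - x)\<close>, the quadratic error tends to 0 and leaves the
  limit inferior nonnegative.\<close>

lemma frechet_subdiffI:
  fixes f :: "'a::real_inner \<Rightarrow> ereal"
  assumes "f x = ereal r" "\<And>z. ereal (r + p \<bullet> (z - x) - C * (norm (z - x))\<^sup>2) \<le> f z"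
  shows "p \<in> frechet_subdiff f x"
proof -
  have "0 \<le> Liminf (at x) (\<lambda>z. (f z - f x - ereal (p \<bullet> (z - x))) / ereal (norm (z - x)))"
    unfolding le_Liminf_iff
  proof (intro allI impI)
    fix c :: ereal assume "c < 0"
    have "((\<lambda>z. - (C * norm (z - x))) \<longlongrightarrow> - (C * norm (x - x))) (at x)"
      by (intro tendsto_intros)
    then have "((\<lambda>z. ereal (- (C * norm (z - x)))) \<longlongrightarrow> 0) (at x)"
      by (auto simp: zero_ereal_def intro: tendsto_ereal)
    then have "eventually (\<lambda>z. c < ereal (- (C * norm (z - x)))) (at x)"
      using \<open>c < 0\<close> by (rule order_tendstoD(1))
    moreover have "eventually (\<lambda>z. z \<noteq> x) (at x)"
      by (simp add: eventually_at_filter)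
    ultimately show "eventually (\<lambda>z. c < (f z - f x - ereal (p \<bullet> (z - x))) / ereal (norm (z - x))) (at x)"
    proof eventually_elim
      case (elim z)
      then have n: "norm (z - x) > 0" by simp
      show ?case
      proof (cases "f z")
        case (real v)
        have "r + p \<bullet> (z - x) - C * (norm (z - x))\<^sup>2 \<le> v" using assms(2)[of z] real by simp
        then have "- (C * norm (z - x)) \<le> (v - r - p \<bullet> (z - x)) / norm (z - x)"
          using n by (simp add: pos_le_divide_eq power2_eq_square algebra_simps)
        with elim(1) have "c < ereal ((v - r - p \<bullet> (z - x)) / norm (z - x))"
          by (meson ereal_less_eq(3) less_le_trans)
        then show ?thesis using real assms(1) n by simp
      next
        case PInf
        then show ?thesis using \<open>c < 0\<close> n assms(1) by auto
      next
        case MInf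
        then show ?thesis using assms(2)[of z] by simp
      qed
    qed
  qed
  then show ?thesis using assms(1) by (simp add: frechet_subdiff_def)
qed

lemma frechet_subset_limiting: "frechet_subdiff f x \<subseteq> limiting_subdiff f x"
proof
  fix p assume p: "p \<in> frechet_subdiff f x"
  then have "f x \<noteq> \<infinity>" by (auto simp: frechet_subdiff_def)
  moreover have "\<exists>xs ps. xs \<longlonglongrightarrow> x \<and> (\<lambda>k. f (xs k)) \<longlonglongrightarrow> f x \<and>
      (\<forall>k. ps k \<in> frechet_subdiff f (xs k)) \<and> ps \<longlonglongrightarrow> p"
    by (rule exI[of _ "\<lambda>_. x"], rule exI[of _ "\<lambda>_. p"]) (use p in simp)
  ultimately show "p \<in> limiting_subdiff f x"
    by (simp add: limiting_subdiff_def)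
qed

lemma deriv_powr:
  fixes t :: real
  assumes "t > 0"
  shows "deriv (\<lambda>t. M * t powr (1 - \<theta>)) t = (1 - \<theta>) * M * t powr (-\<theta>)"
  using DERIV_cmult[OF has_real_derivative_powr[OF assms], of M "1 - \<theta>"]
  by (intro DERIV_imp_deriv) (simp add: mult_ac)

text \<open>The iteration enters only through these estimates; convexity survives as the minorant
  \<open>lower\<close>, which allows a nonconvex \<open>F\<close>. The index of \<open>p n\<close>
  is that of the step, so it is a subgradient at \<open>w (Suc n)\<close>.\<close>

locale KL_scheme =
  fixes F :: "'a::real_inner \<Rightarrow> ereal" and M \<theta> a C D :: real
    and w p :: "nat \<Rightarrow> 'a" and wlim :: 'a and f :: "nat \<Rightarrow> real"
  assumes KL: "KL_function F (\<lambda>t. M * t powr (1 - \<theta>))" and M: "M > 0"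
    and theta: "0 \<le> \<theta>" "\<theta> < 1" and lsc: "lsc F" and w_lim: "w \<longlonglongrightarrow> wlim"
    and a: "a > 0" and D: "D > 0"
    and F_w: "\<And>n. F (w n) = ereal (f n)"
    and lower: "\<And>n z. ereal (f (Suc n) + p n \<bullet> (z - w (Suc n)) - C * (norm (z - w (Suc n)))\<^sup>2) \<le> F z"
    and p_bound: "\<And>n. norm (p n) \<le> D * norm (w (Suc n) - w n)"
    and descent: "\<And>n. f (Suc n) + a * (norm (w (Suc n) - w n))\<^sup>2 \<le> f n"
begin

lemma step_tendsto_0: "(\<lambda>n. norm (w (Suc n) - w n)) \<longlonglongrightarrow> 0"
proof -
  have "(\<lambda>n. norm (w (Suc n) - w n)) \<longlonglongrightarrow> norm (wlim - wlim)"
    using w_lim LIMSEQ_Suc[OF w_lim] by (intro tendsto_intros)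
  then show ?thesis by simp
qed

lemma p_tendsto_0: "p \<longlonglongrightarrow> 0"
proof (rule Lim_null_comparison)
  show "(\<lambda>n. D * norm (w (Suc n) - w n)) \<longlonglongrightarrow> 0"
    using tendsto_mult_right_zero[OF step_tendsto_0] .
qed (use p_bound in simp)

lemma f_decseq: "decseq f"
proof (rule decseq_SucI)
  fix n
  have "a * (norm (w (Suc n) - w n))\<^sup>2 \<ge> 0" using a by simp
  then show "f (Suc n) \<le> f n" using descent[of n] by linarith
qed

text \<open>Lower semicontinuity keeps the values from falling below \<open>F wlim\<close> in the
  limit. The opposite bound is the minorant at \<open>z = wlim\<close>, whose linear and quadratic
  terms tend to 0.\<close>

lemma value_limit:
  obtains fl where "F wlim = ereal fl" "f \<longlonglongrightarrow> fl"
proof -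
  have above: "eventually (\<lambda>n. c < ereal (f n)) sequentially" if "c < F wlim" for c
    using filterlim_iff[THEN iffD1, OF w_lim, rule_format, OF lsc_eventually_nhds[OF lsc that]] F_w
    by simp
  \<comment> \<open>Finiteness comes first: a larger value at the limit would force some
    \<open>f n\<close> above \<open>f 0\<close>, against monotonicity.\<close>
  have "F wlim \<le> ereal (f 0)"
  proof (rule ccontr)
    assume "\<not> F wlim \<le> ereal (f 0)"
    then obtain n where "ereal (f 0) < ereal (f n)"
      using above[of "ereal (f 0)"] by (auto simp: eventually_sequentially not_le)
    then show False using decseqD[OF f_decseq, of 0 n] by simp
  qed
  then obtain fl where fl: "F wlim = ereal fl"
    using lower[of 0 wlim] by (cases "F wlim") auto
  have "(\<lambda>n. f (Suc n)) \<longlonglongrightarrow> fl"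
  proof (rule order_tendstoI)
    fix c assume "c < fl"
    then have "eventually (\<lambda>n. c < f n) sequentially" using above[of "ereal c"] fl by simp
    then show "eventually (\<lambda>n. c < f (Suc n)) sequentially"
      using eventually_sequentially_Suc[of "\<lambda>n. c < f n"] by blast
  next
    fix c assume c: "fl < c"
    have "(\<lambda>n. fl - p n \<bullet> (wlim - w (Suc n)) + C * (norm (wlim - w (Suc n)))\<^sup>2)
      \<longlonglongrightarrow> fl - 0 \<bullet> (wlim - wlim) + C * (norm (wlim - wlim))\<^sup>2"
      by (intro tendsto_intros p_tendsto_0 LIMSEQ_Suc[OF w_lim])
    then have "eventually (\<lambda>n. fl - p n \<bullet> (wlim - w (Suc n)) + C * (norm (wlim - w (Suc n)))\<^sup>2 < c) sequentially"
      using c by (intro order_tendstoD(2)) auto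
    then show "eventually (\<lambda>n. f (Suc n) < c) sequentially"
    proof eventually_elim
      case (elim n)
      then show ?case using lower[of n wlim] fl by simp
    qed
  qed
  then show thesis using that[OF fl] filterlim_sequentially_Suc[of f] by blast
qed

lemma p_subgradient: "p n \<in> limiting_subdiff F (w (Suc n))"
  using frechet_subdiffI[of F, OF F_w lower] frechet_subset_limiting by blast

lemma KL_gap:
  obtains N fl where "f \<longlonglongrightarrow> fl" "\<And>n. fl \<le> f n" "\<And>n. n \<ge> N \<Longrightarrow> f n \<le> fl + 1"
    "\<And>n. n \<ge> N \<Longrightarrow> fl < f (Suc n) \<Longrightarrow>
       (f (Suc n) - fl) powr \<theta> \<le> (1 - \<theta>) * M * D * norm (w (Suc n) - w n)"
proof -
  obtain fl where fl: "F wlim = ereal fl" "f \<longlonglongrightarrow> fl" by (rule value_limit)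
  have ge: "fl \<le> f n" for n using decseq_ge[OF f_decseq fl(2)] .
  \<comment> \<open>KL is available only at points with nonempty limiting subdifferential; here 0
    belongs to it.\<close>
  have "\<exists>xs ps. xs \<longlonglongrightarrow> wlim \<and> (\<lambda>k. F (xs k)) \<longlonglongrightarrow> F wlim \<and>
      (\<forall>k. ps k \<in> frechet_subdiff F (xs k)) \<and> ps \<longlonglongrightarrow> 0"
  proof (rule exI[of _ "\<lambda>n. w (Suc n)"], rule exI[of _ p], intro conjI allI)
    show "(\<lambda>k. F (w (Suc k))) \<longlonglongrightarrow> F wlim"
      unfolding F_w fl(1) by (rule tendsto_ereal[OF LIMSEQ_Suc[OF fl(2)]])
  qed (fact LIMSEQ_Suc[OF w_lim] frechet_subdiffI[of F, OF F_w lower] p_tendsto_0)+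
  then have "limiting_subdiff F wlim \<noteq> {}"
    using fl(1) by (auto simp: limiting_subdiff_def)
  then obtain \<eta> U where U: "0 < \<eta>" "open U" "wlim \<in> U" and
    ineq: "\<And>u. u \<in> U \<Longrightarrow> F wlim < F u \<Longrightarrow> F u < F wlim + \<eta> \<Longrightarrow>
      1 \<le> ereal (deriv (\<lambda>t. M * t powr (1 - \<theta>)) (real_of_ereal (F u - F wlim))) * dist_origin (limiting_subdiff F u)"
    using KL unfolding KL_function_def by blast
  have "eventually (\<lambda>n. w n \<in> U) sequentially"
    using topological_tendstoD[OF w_lim U(2,3)] .
  moreover have "ereal fl < ereal fl + \<eta>"
    using U(1) by (cases \<eta>) auto
  then have "eventually (\<lambda>n. ereal (f n) < ereal fl + \<eta>) sequentially"
    using tendsto_ereal[OF fl(2)] by (rule order_tendstoD(2)[rotated])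
  \<comment> \<open>A gap of at most 1 allows powers with different exponents to be compared
    later.\<close>
  moreover have "eventually (\<lambda>n. f n < fl + 1) sequentially"
    using fl(2) by (rule order_tendstoD(2)) simp
  ultimately have "eventually (\<lambda>n. w n \<in> U \<and> ereal (f n) < ereal fl + \<eta> \<and> f n < fl + 1) sequentially"
    by eventually_elim auto
  then obtain N where N: "\<And>n. n \<ge> N \<Longrightarrow> w n \<in> U \<and> ereal (f n) < ereal fl + \<eta> \<and> f n < fl + 1"
    by (auto simp: eventually_sequentially)
  show thesis
  proof (rule that[OF fl(2) ge])
    show "f n \<le> fl + 1" if "n \<ge> N" for n using N[OF that] by simp
    fix n assume n: "n \<ge> N" and pos: "fl < f (Suc n)"
    define t where "t = f (Suc n) - fl"
    have t: "t > 0" using pos by (simp add: t_def)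
    have "1 \<le> ereal ((1 - \<theta>) * M * t powr (-\<theta>)) * dist_origin (limiting_subdiff F (w (Suc n)))"
      using ineq[of "w (Suc n)"] N[of "Suc n"] n pos fl(1) F_w[of "Suc n"] deriv_powr[OF t, of M \<theta>]
      by (simp add: t_def)
    also have "\<dots> \<le> ereal ((1 - \<theta>) * M * t powr (-\<theta>)) * ereal (norm (p n))"
      using p_subgradient[of n] theta M unfolding dist_origin_def
      by (intro ereal_mult_left_mono INF_lower) auto
    finally have "1 \<le> (1 - \<theta>) * M * t powr (-\<theta>) * norm (p n)" by simp
    also have "\<dots> \<le> (1 - \<theta>) * M * t powr (-\<theta>) * (D * norm (w (Suc n) - w n))"
      using theta M by (intro mult_left_mono p_bound) auto
    finally have "1 \<le> (1 - \<theta>) * M * D * norm (w (Suc n) - w n) / t powr \<theta>"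
      by (simp add: powr_minus divide_inverse mult_ac)
    then show "(f (Suc n) - fl) powr \<theta> \<le> (1 - \<theta>) * M * D * norm (w (Suc n) - w n)"
      using t by (simp add: t_def)
  qed
qed

text \<open>Once the gap is zero, descent forbids any further movement, so the iterate already
  equals its limit; otherwise the gap stays positive and KL applies at every late index.\<close>

lemma stationary_or_KL_descent:
  obtains (stationary) N where "\<And>n. n \<ge> N \<Longrightarrow> w n = wlim"
  | (active) N r where "KL_descent r (\<lambda>n. norm (w (n + Suc N) - w (n + N))) (\<lambda>n. w (n + Suc N))
      wlim a ((1 - \<theta>) * M * D) \<theta>" "r \<longlonglongrightarrow> 0"
proof -
  obtain N fl where fl: "f \<longlonglongrightarrow> fl" "\<And>n. fl \<le> f n" "\<And>n. n \<ge> N \<Longrightarrow> f n \<le> fl + 1"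
    and KLf: "\<And>n. n \<ge> N \<Longrightarrow> fl < f (Suc n) \<Longrightarrow>
       (f (Suc n) - fl) powr \<theta> \<le> (1 - \<theta>) * M * D * norm (w (Suc n) - w n)"
    by (rule KL_gap) blast
  show thesis
  proof (cases "\<exists>m. f m = fl")
    case True
    then obtain m where m: "f m = fl" by blast
    have const: "f n = fl" if "n \<ge> m" for n
      using decseqD[OF f_decseq that] fl(2)[of n] m by simp
    have eq: "w (n + m) = w m" for n
    proof (induction n)
      case (Suc n)
      have "a * (norm (w (Suc (n + m)) - w (n + m)))\<^sup>2 \<le> 0"
        using descent[of "n + m"] const[of "n + m"] const[of "Suc (n + m)"] by simp
      then have "w (Suc (n + m)) = w (n + m)" using a by (simp add: mult_le_0_iff)
      then show ?case using Suc by simp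
    qed simp
    have "(\<lambda>n. w (n + m)) \<longlonglongrightarrow> wlim" by (rule LIMSEQ_ignore_initial_segment[OF w_lim])
    then have "w m = wlim" by (simp add: eq LIMSEQ_const_iff)
    then have "w n = wlim" if "n \<ge> m" for n using eq[of "n - m"] that by simp
    then show thesis by (rule stationary)
  next
    case False
    then have pos: "fl < f n" for n using fl(2)[of n] by (metis order_less_le)
    \<comment> \<open>The shift is \<open>Suc N\<close> because KL at an iterate involves the step
      leading to it, which must have index at least \<open>N\<close>.\<close>
    have "(\<lambda>n. f (n + Suc N) - fl) \<longlonglongrightarrow> fl - fl"
      by (intro tendsto_intros LIMSEQ_ignore_initial_segment[OF fl(1)])
    then have lim0: "(\<lambda>n. f (n + Suc N) - fl) \<longlonglongrightarrow> 0" by simp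
    have "KL_descent (\<lambda>n. f (n + Suc N) - fl) (\<lambda>n. norm (w (n + Suc N) - w (n + N)))
      (\<lambda>n. w (n + Suc N)) wlim a ((1 - \<theta>) * M * D) \<theta>"
    proof
      fix n
      show "f (n + Suc N) - fl > 0" using pos by simp
      show "f (n + Suc N) - fl \<le> 1" using fl(3)[of "n + Suc N"] by simp
      show "a * (norm (w (Suc n + Suc N) - w (Suc n + N)))\<^sup>2 \<le> f (n + Suc N) - fl - (f (Suc n + Suc N) - fl)"
        using descent[of "n + Suc N"] by simp
      show "(f (n + Suc N) - fl) powr \<theta> \<le> (1 - \<theta>) * M * D * norm (w (n + Suc N) - w (n + N))"
        using KLf[of "n + N"] pos by simp
      show "norm (w (Suc n + Suc N) - w (n + Suc N)) \<le> norm (w (Suc n + Suc N) - w (Suc n + N))"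
        by simp
      show "(\<lambda>n. w (n + Suc N)) \<longlonglongrightarrow> wlim" by (rule LIMSEQ_ignore_initial_segment[OF w_lim])
    qed (use a M D theta in auto)
    then show thesis using lim0 by (rule active)
  qed
qed

lemma rate_0:
  assumes "\<theta> = 0"
  shows "eventually (\<lambda>n. w n = wlim) sequentially"
proof (cases rule: stationary_or_KL_descent)
  case (stationary N)
  then show ?thesis by (auto simp: eventually_sequentially)
next
  case (active N r)
  then show ?thesis using KL_descent.finite_termination assms by blast
qed

lemma rate_geometric:
  assumes "\<theta> \<le> 1/2"
  obtains c q where "0 < q" "q < 1" "eventually (\<lambda>n. norm (w n - wlim) \<le> c * q ^ n) sequentially"
proof (cases rule: stationary_or_KL_descent)
  case (stationary N)
  then show ?thesis
    using that[of "1/2" 0] by (auto simp: eventually_sequentially)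
next
  case (active N r)
  obtain c q where cq: "0 < q" "q < 1" "\<And>n. norm (w (Suc n + Suc N) - wlim) \<le> c * q ^ n"
    by (rule KL_descent.geometric_rate[OF active(1) assms]) (rule that)
  \<comment> \<open>Since \<open>q > 0\<close>, the index shift becomes a constant factor.\<close>
  have "norm (w n - wlim) \<le> c / q ^ (N + 2) * q ^ n" if n: "n \<ge> N + 2" for n
  proof -
    obtain k where k: "n = N + 2 + k" using n le_Suc_ex by blast
    have "norm (w n - wlim) \<le> c * q ^ (n - (N + 2))"
      using cq(3)[of k] by (simp add: k add.commute)
    also have "\<dots> = c / q ^ (N + 2) * q ^ n"
      using n cq(1) by (simp add: power_diff)
    finally show ?thesis .
  qed
  then have "eventually (\<lambda>n. norm (w n - wlim) \<le> c / q ^ (N + 2) * q ^ n) sequentially"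
    by (rule eventually_sequentiallyI)
  then show ?thesis by (rule that[OF cq(1,2)])
qed

lemma rate_sublinear:
  assumes "1/2 < \<theta>"
  obtains c where "eventually (\<lambda>n. norm (w n - wlim)
    \<le> c * real (Suc n) powr (- ((1 - \<theta>) / (2 * \<theta> - 1)))) sequentially"
proof (cases rule: stationary_or_KL_descent)
  case (stationary N)
  then show ?thesis
    using that[of 0] by (auto simp: eventually_sequentially)
next
  case (active N r)
  define \<rho> where "\<rho> = (1 - \<theta>) / (2 * \<theta> - 1)"
  have rho: "\<rho> \<ge> 0" using theta assms by (simp add: \<rho>_def)
  obtain c where c: "c \<ge> 0"
    "\<And>n. n \<ge> 1 \<Longrightarrow> norm (w (Suc n + Suc N) - wlim) \<le> c * real n powr (-\<rho>)"
    using KL_descent.sublinear_rate[OF active(1) assms] unfolding \<rho>_def by blast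
  \<comment> \<open>The threshold makes \<open>n - (N + 2)\<close> at least half of
    \<open>Suc n\<close>, so the shift costs only a constant factor.\<close>
  have "norm (w n - wlim) \<le> c * (1/2) powr (-\<rho>) * real (Suc n) powr (-\<rho>)" if "n \<ge> 2 * N + 6" for n
  proof -
    have "N + 2 \<le> n" using that by simp
    then obtain k where k: "n = N + 2 + k" using le_Suc_ex by blast
    have "norm (w n - wlim) \<le> c * real (n - (N + 2)) powr (-\<rho>)"
      using c(2)[of k] that by (simp add: k add.commute)
    also have "\<dots> \<le> c * (1/2 * real (Suc n)) powr (-\<rho>)"
      using that rho c(1) by (intro mult_left_mono powr_mono2') auto
    also have "\<dots> = c * (1/2) powr (-\<rho>) * real (Suc n) powr (-\<rho>)"
      using powr_mult[of "1/2" "real (Suc n)" "-\<rho>"] by (simp only: mult.assoc)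
    finally show ?thesis .
  qed
  then show ?thesis using that unfolding \<rho>_def by (auto simp: eventually_sequentially)
qed

end

subsection \<open>Convergence rates of the iteration\<close>

theorem lemma4:
  fixes g :: "'a::real_inner \<Rightarrow> ereal" and h :: "'b::real_inner \<Rightarrow> ereal"
    and \<phi> :: "'a \<Rightarrow> real" and \<phi>' :: "'a \<Rightarrow> 'a" and K :: "'a \<Rightarrow> 'b"
    and \<beta> M \<theta> :: real and \<gamma> \<mu> :: "nat \<Rightarrow> real"
    and x :: "nat \<Rightarrow> 'a" and y :: "nat \<Rightarrow> 'b" and xbar :: 'a and ybar :: 'b
    and \<Phi> :: "'a \<times> 'b \<Rightarrow> ereal"
  assumes fin_dim_H: "\<exists>B :: 'a set. finite B \<and> span B = UNIV"
    and fin_dim_G: "\<exists>B :: 'b set. finite B \<and> span B = UNIV"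
    and g: "proper g" "convex_ereal g" "lsc g"
    and h: "proper h" "convex_ereal h" "lsc h"
    and beta: "\<beta> > 0"
    and phi_convex: "convex_on UNIV \<phi>"
    and phi_grad: "\<And>z. GDERIV \<phi> z :> \<phi>' z"
    and phi_lipschitz: "lipschitz_on (1 / \<beta>) UNIV \<phi>'"
    and K: "linear K"
    and gamma_pos: "\<And>n. \<gamma> n > 0" and mu_pos: "\<And>n. \<mu> n > 0"
    and gamma_bounds: "0 < (INF n. ereal (\<gamma> n))" "(SUP n. ereal (\<gamma> n)) < ereal \<beta>"
    and mu_bounds: "0 < (INF n. ereal (\<mu> n))" "(SUP n. ereal (\<mu> n)) < \<infinity>"
    and x_step: "\<And>n. x (Suc n) =
      Prox (\<gamma> n) g (x n + \<gamma> n *\<^sub>R adjoint K (y n) - \<gamma> n *\<^sub>R \<phi>' (x n))"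
    and y_step: "\<And>n. y (Suc n) =
      Prox (\<mu> n) (fenchel_conjugate h) (y n + \<mu> n *\<^sub>R K (x (Suc n)))"
    and Phi: "\<And>u v. \<Phi> (u, v) = g u + ereal (\<phi> u) + fenchel_conjugate h v - ereal (v \<bullet> K u)"
    and Phi_bounded_below: "\<exists>m::real. \<forall>w. ereal m \<le> \<Phi> w"
    and M: "M > 0" and theta: "0 \<le> \<theta>" "\<theta> < 1"
    and Phi_KL: "KL_function \<Phi> (\<lambda>t. M * t powr (1 - \<theta>))"
    and x_lim: "x \<longlonglongrightarrow> xbar" and y_lim: "y \<longlonglongrightarrow> ybar"
  shows "(\<theta> = 0 \<longrightarrow> (\<exists>n0. \<forall>n\<ge>n0. x n = x n0 \<and> y n = y n0)) \<and>
    (0 < \<theta> \<and> \<theta> \<le> 1/2 \<longrightarrow>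
       (\<exists>c q::real. c > 0 \<and> 0 \<le> q \<and> q < 1 \<and>
          (\<forall>n. norm (x n - xbar) \<le> c * q ^ n \<and> norm (y n - ybar) \<le> c * q ^ n))) \<and>
    (1/2 < \<theta> \<and> \<theta> < 1 \<longrightarrow>
       (\<exists>c::real. c > 0 \<and>
          (\<forall>n\<ge>1. norm (x n - xbar) \<le> c * real n powr (- ((1 - \<theta>) / (2 * \<theta> - 1))) \<and>
                 norm (y n - ybar) \<le> c * real n powr (- ((1 - \<theta>) / (2 * \<theta> - 1))))))"
proof -
  define A where "A = adjoint K"
  have A: "z \<bullet> A v = K z \<bullet> v" for z v
    unfolding A_def by (rule adjoint_works_finite_dim[OF fin_dim_H K])
  obtain C where C: "C \<ge> 0" "\<And>z. norm (K z) \<le> C * norm z"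
    using linear_bounded_finite_dim[OF fin_dim_H K] by blast
  define H where "H = fenchel_conjugate h"
  have H: "proper H" "convex_ereal H" "lsc H"
    unfolding H_def using proper_fenchel_conjugate[OF fin_dim_G h]
      convex_ereal_fenchel_conjugate lsc_fenchel_conjugate by auto
  obtain \<gamma>1 where \<gamma>1: "0 < \<gamma>1" "\<And>n. \<gamma>1 \<le> \<gamma> n"
    using INF_ereal_pos_lower_bound[OF gamma_bounds(1)] by blast
  obtain \<gamma>2 where \<gamma>2: "\<gamma>2 < \<beta>" "\<And>n. \<gamma> n \<le> \<gamma>2"
    using SUP_ereal_upper_bound[OF gamma_bounds(2)] by auto
  obtain \<mu>1 where \<mu>1: "0 < \<mu>1" "\<And>n. \<mu>1 \<le> \<mu> n"
    using INF_ereal_pos_lower_bound[OF mu_bounds(1)] by blast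
  obtain \<mu>2 where \<mu>2: "\<And>n. \<mu> n \<le> \<mu>2"
    using SUP_ereal_upper_bound[OF mu_bounds(2)] by blast
  have "\<gamma>2 > 0" "\<mu>2 > 0"
    using gamma_pos[of 0] \<gamma>2(2)[of 0] mu_pos[of 0] \<mu>2[of 0] by linarith+

  \<comment> \<open>Optimality of the proximal points makes these subgradients of \<open>g\<close>
    and \<open>H\<close> at the new iterates.\<close>
  define \<xi> where "\<xi> n = (x n + \<gamma> n *\<^sub>R A (y n) - \<gamma> n *\<^sub>R \<phi>' (x n) - x (Suc n)) /\<^sub>R \<gamma> n" for n
  define \<zeta> where "\<zeta> n = (y n + \<mu> n *\<^sub>R K (x (Suc n)) - y (Suc n)) /\<^sub>R \<mu> n" for n
  have gx: "g (x (Suc n)) \<noteq> \<infinity>" "g (x (Suc n)) + ereal (\<xi> n \<bullet> (z - x (Suc n))) \<le> g z" for n z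
    using Prox_subgradient[OF fin_dim_H g gamma_pos]
    unfolding \<xi>_def A_def x_step[symmetric] by (simp_all add: x_step)
  have Hy: "H (y (Suc n)) \<noteq> \<infinity>" "H (y (Suc n)) + ereal (\<zeta> n \<bullet> (z - y (Suc n))) \<le> H z" for n z
    using Prox_subgradient[OF fin_dim_G H mu_pos]
    unfolding \<zeta>_def H_def by (simp_all add: y_step)
  define G where "G n = real_of_ereal (g (x (Suc n)))" for n
  define J where "J n = real_of_ereal (H (y (Suc n)))" for n
  have G: "g (x (Suc n)) = ereal (G n)" for n
    using gx(1)[of n] g(1) by (cases "g (x (Suc n))") (auto simp: G_def proper_def)
  have J: "H (y (Suc n)) = ereal (J n)" for n
    using Hy(1)[of n] H(1) by (cases "H (y (Suc n))") (auto simp: J_def proper_def)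
  have g_sub: "ereal (G n + \<xi> n \<bullet> (z - x (Suc n))) \<le> g z" for n z
    using gx(2)[of n z] G[of n] by simp
  have H_sub: "ereal (J n + \<zeta> n \<bullet> (z - y (Suc n))) \<le> H z" for n z
    using Hy(2)[of n z] J[of n] by simp

  \<comment> \<open>Starting at index 1 guarantees finite values, as every later iterate is a
    proximal point.\<close>
  define w where "w n = (x (Suc n), y (Suc n))" for n
  define f where "f n = G n + \<phi> (x (Suc n)) + J n - y (Suc n) \<bullet> K (x (Suc n))" for n
  \<comment> \<open>To the proximal subgradients this adds the derivatives of the smooth and
    coupling terms, taken at the new iterate.\<close>
  define p where "p n = (\<xi> (Suc n) + \<phi>' (x (Suc (Suc n))) - A (y (Suc (Suc n))),
    \<zeta> (Suc n) - K (x (Suc (Suc n))))" for n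
  \<comment> \<open>The worst descent coefficients of the two steps; the first is positive because
    \<open>\<gamma>2 < \<beta>\<close>.\<close>
  define a where "a = min (1 / \<gamma>2 - 1 / \<beta>) (1 / \<mu>2)"
  define D where "D = 1 / \<gamma>1 + C + 1 / \<beta> + 1 / \<mu>1"
  have Phi_eq: "\<Phi> z = g (fst z) + ereal (\<phi> (fst z)) + H (snd z) - ereal (snd z \<bullet> K (fst z))" for z
    using Phi[of "fst z" "snd z"] by (simp add: H_def)

  interpret KL_scheme \<Phi> M \<theta> a C D w p "(xbar, ybar)" f
  proof
    show "lsc \<Phi>"
    proof -
      have bK: "bounded_linear K"
        using K C(2) by (intro bounded_linear_intro[of K C])
          (auto simp: linear_add linear_cmul mult.commute)
      \<comment> \<open>Gathering the finite terms in one continuous real function leaves sums free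
        of \<open>-\<infinity>\<close>.\<close>
      have "lsc (\<lambda>z :: 'a \<times> 'b. ereal (\<phi> (fst z) - snd z \<bullet> K (fst z)))"
      proof (rule lsc_continuous)
        fix z :: "'a \<times> 'b"
        have "isCont \<phi> (fst z)"
          using phi_grad[of "fst z"] has_derivative_continuous unfolding gderiv_def by blast
        then have "isCont (\<lambda>z :: 'a \<times> 'b. \<phi> (fst z)) z"
          using isCont_o2[of z fst \<phi>] by simp
        moreover have "isCont (\<lambda>z :: 'a \<times> 'b. K (fst z)) z"
          by (intro bounded_linear.isCont[OF bK] continuous_intros)
        ultimately show "isCont (\<lambda>z :: 'a \<times> 'b. \<phi> (fst z) - snd z \<bullet> K (fst z)) z"
          by (intro continuous_intros)
      qed
      moreover have "lsc (\<lambda>z. g (fst z) + H (snd z))"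
        using g(1) H(1)
        by (intro lsc_add lsc_compose[OF g(3)] lsc_compose[OF H(3)] continuous_intros)
           (auto simp: proper_def)
      ultimately have "lsc (\<lambda>z. g (fst z) + H (snd z) + ereal (\<phi> (fst z) - snd z \<bullet> K (fst z)))"
        using g(1) H(1) by (intro lsc_add[where f = "\<lambda>z. g (fst z) + H (snd z)"]) (auto simp: proper_def)
      also have "(\<lambda>z. g (fst z) + H (snd z) + ereal (\<phi> (fst z) - snd z \<bullet> K (fst z))) = \<Phi>"
      proof
        fix z
        show "g (fst z) + H (snd z) + ereal (\<phi> (fst z) - snd z \<bullet> K (fst z)) = \<Phi> z"
          using g(1) H(1) unfolding Phi_eq
          by (cases "g (fst z)"; cases "H (snd z)") (auto simp: proper_def)
      qed
      finally show ?thesis .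
    qed
    show "w \<longlonglongrightarrow> (xbar, ybar)"
      unfolding w_def by (intro tendsto_Pair LIMSEQ_Suc x_lim y_lim)
    show "a > 0"
      using \<gamma>2(1) \<open>\<gamma>2 > 0\<close> \<open>\<mu>2 > 0\<close> beta by (simp add: a_def frac_less2)
    show "D > 0"
      using \<gamma>1(1) \<mu>1(1) C(1) beta by (simp add: D_def add_pos_pos add_pos_nonneg)
    fix n
    let ?x = "x (Suc n)" and ?x' = "x (Suc (Suc n))" and ?y = "y (Suc n)" and ?y' = "y (Suc (Suc n))"
    show "\<Phi> (w n) = ereal (f n)"
      unfolding Phi_eq w_def f_def by (simp add: G J)
    show "ereal (f (Suc n) + p n \<bullet> (z - w (Suc n)) - C * (norm (z - w (Suc n)))\<^sup>2) \<le> \<Phi> z" for z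
      unfolding Phi_eq f_def p_def w_def
      by (rule coupled_lower_bound[OF g_sub H_sub convex_gradient_ineq[OF phi_convex phi_grad] K C(2,1) A])
    define d where "d = norm (w (Suc n) - w n)"
    have dx: "norm (?x' - ?x) \<le> d" and dy: "norm (?y' - ?y) \<le> d"
      using norm_fst_le[of "?x' - ?x" "?y' - ?y"] norm_snd_le[of "?y' - ?y" "?x' - ?x"]
      by (simp_all add: d_def w_def)
    have "norm (fst (p n)) \<le> 1 / \<gamma> (Suc n) * norm (?x' - ?x) + C * norm (?y' - ?y) + 1 / \<beta> * norm (?x' - ?x)"
      unfolding p_def \<xi>_def fst_conv
      using lipschitz_onD[OF phi_lipschitz, of ?x' ?x]
      by (intro primal_residual_bound[OF A C(2,1) _ gamma_pos]) (simp add: dist_norm)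
    also have "\<dots> \<le> 1 / \<gamma>1 * d + C * d + 1 / \<beta> * d"
      using \<gamma>1 C(1) beta dx dy by (intro add_mono mult_mono frac_le) auto
    finally have p1: "norm (fst (p n)) \<le> 1 / \<gamma>1 * d + C * d + 1 / \<beta> * d" .
    \<comment> \<open>The dual step uses the new primal iterate, so the terms with \<open>K\<close>
      cancel exactly.\<close>
    have "snd (p n) = (1 / \<mu> (Suc n)) *\<^sub>R (?y - ?y')"
      using mu_pos[of "Suc n"] by (simp add: p_def \<zeta>_def algebra_simps divide_inverse)
    then have "norm (snd (p n)) = 1 / \<mu> (Suc n) * norm (?y' - ?y)"
      using mu_pos[of "Suc n"] by (simp add: norm_minus_commute)
    also have "\<dots> \<le> 1 / \<mu>1 * d"
      using \<mu>1 dy by (intro mult_mono frac_le) auto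
    finally have "norm (fst (p n)) + norm (snd (p n)) \<le> D * d"
      using p1 by (simp add: D_def distrib_right)
    then show "norm (p n) \<le> D * norm (w (Suc n) - w n)"
      using norm_Pair_le[of "fst (p n)" "snd (p n)"] by (simp add: d_def)
    have "a * (norm (?x' - ?x))\<^sup>2 \<le> (1 / \<gamma> (Suc n) - 1 / \<beta>) * (norm (?x' - ?x))\<^sup>2"
      using \<gamma>2(2)[of "Suc n"] gamma_pos[of "Suc n"]
      by (intro mult_right_mono) (auto simp: a_def frac_le min.coboundedI1)
    moreover have "a * (norm (?y' - ?y))\<^sup>2 \<le> 1 / \<mu> (Suc n) * (norm (?y' - ?y))\<^sup>2"
      using \<mu>2[of "Suc n"] mu_pos[of "Suc n"]
      by (intro mult_right_mono) (auto simp: a_def frac_le min.coboundedI2)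
    moreover have "G (Suc n) + \<phi> ?x' + J (Suc n) - ?y' \<bullet> K ?x'
        + (1 / \<gamma> (Suc n) - 1 / \<beta>) * (norm (?x' - ?x))\<^sup>2 + 1 / \<mu> (Suc n) * (norm (?y' - ?y))\<^sup>2 \<le> f n"
      unfolding f_def
    proof (rule primal_dual_step_descent[OF _ _ _ A K gamma_pos mu_pos])
      show "G (Suc n) + ((?x + \<gamma> (Suc n) *\<^sub>R A ?y - \<gamma> (Suc n) *\<^sub>R \<phi>' ?x - ?x') /\<^sub>R \<gamma> (Suc n)) \<bullet> (?x - ?x') \<le> G n"
        using g_sub[of "Suc n" ?x] by (simp add: G \<xi>_def)
      show "J (Suc n) + ((?y + \<mu> (Suc n) *\<^sub>R K ?x' - ?y') /\<^sub>R \<mu> (Suc n)) \<bullet> (?y - ?y') \<le> J n"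
        using H_sub[of "Suc n" ?y] by (simp add: J \<zeta>_def)
      show "\<phi> ?x' \<le> \<phi> ?x + \<phi>' ?x \<bullet> (?x' - ?x) + 1 / \<beta> * (norm (?x' - ?x))\<^sup>2"
        by (rule convex_lipschitz_gradient_upper[OF phi_convex phi_grad phi_lipschitz])
    qed
    moreover have "(norm (w (Suc n) - w n))\<^sup>2 = (norm (?x' - ?x))\<^sup>2 + (norm (?y' - ?y))\<^sup>2"
      by (simp add: w_def norm_Pair)
    ultimately show "f (Suc n) + a * (norm (w (Suc n) - w n))\<^sup>2 \<le> f n"
      unfolding f_def[of "Suc n"] by (simp add: distrib_left)
  qed (use Phi_KL M theta in auto)

  define e where "e n = max (norm (x n - xbar)) (norm (y n - ybar))" for n
  have e_le: "e (Suc n) \<le> norm (w n - (xbar, ybar))" for n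
    using norm_fst_le[of "x (Suc n) - xbar" "y (Suc n) - ybar"]
      norm_snd_le[of "y (Suc n) - ybar" "x (Suc n) - xbar"] by (simp add: w_def e_def)
  \<comment> \<open>\<open>w n\<close> carries the iterates of index \<open>Suc n\<close>, hence the
    comparison with \<open>b (Suc n)\<close>.\<close>
  have transfer: "eventually (\<lambda>n. e n \<le> c * b n) sequentially"
    if ev: "eventually (\<lambda>n. norm (w n - (xbar, ybar)) \<le> c * b (Suc n)) sequentially"
    for c and b :: "nat \<Rightarrow> real"
  proof -
    from ev have "eventually (\<lambda>n. e (Suc n) \<le> c * b (Suc n)) sequentially"
      by eventually_elim (rule order_trans[OF e_le])
    then show ?thesis
      by (simp only: eventually_sequentially_Suc[of "\<lambda>n. e n \<le> c * b n"])
  qed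
  show ?thesis
  proof (intro conjI impI)
    assume "\<theta> = 0"
    have "eventually (\<lambda>n. x (Suc n) = xbar \<and> y (Suc n) = ybar) sequentially"
      using rate_0[OF \<open>\<theta> = 0\<close>] by (simp add: w_def)
    then obtain N where N: "\<And>n. n \<ge> N \<Longrightarrow> x (Suc n) = xbar \<and> y (Suc n) = ybar"
      by (auto simp: eventually_sequentially)
    have "x n = xbar \<and> y n = ybar" if "n \<ge> Suc N" for n
      using N[of "n - 1"] that by simp
    then show "\<exists>n0. \<forall>n\<ge>n0. x n = x n0 \<and> y n = y n0"
      by (intro exI[of _ "Suc N"]) simp
  next
    assume "0 < \<theta> \<and> \<theta> \<le> 1/2"
    then have "\<theta> \<le> 1/2" by simp
    then obtain c q where q: "0 < q" "q < 1"
      and c: "eventually (\<lambda>n. norm (w n - (xbar, ybar)) \<le> c * q ^ n) sequentially"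
      by (rule rate_geometric)
    have "eventually (\<lambda>n. norm (w n - (xbar, ybar)) \<le> c / q * q ^ Suc n) sequentially"
      using c q by simp
    note bound = transfer[of "c / q" "\<lambda>n. q ^ n", OF this]
    have pos: "q ^ n > 0" if "n \<ge> 0" for n using q by simp
    obtain c' where "c' > 0" "\<And>n. n \<ge> 0 \<Longrightarrow> e n \<le> c' * q ^ n"
      using eventually_bound_imp_bound[of 0 "\<lambda>n. q ^ n", OF pos bound] by blast
    then show "\<exists>c q::real. c > 0 \<and> 0 \<le> q \<and> q < 1 \<and>
        (\<forall>n. norm (x n - xbar) \<le> c * q ^ n \<and> norm (y n - ybar) \<le> c * q ^ n)"
      using q by (intro exI[of _ c'] exI[of _ q]) (simp add: e_def)
  next
    assume "1/2 < \<theta> \<and> \<theta> < 1"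
    then have "1/2 < \<theta>" by simp
    let ?b = "\<lambda>n. real n powr (- ((1 - \<theta>) / (2 * \<theta> - 1)))"
    obtain c where "eventually (\<lambda>n. norm (w n - (xbar, ybar)) \<le> c * ?b (Suc n)) sequentially"
      using \<open>1/2 < \<theta>\<close> by (rule rate_sublinear)
    note bound = transfer[of c ?b, OF this]
    \<comment> \<open>At \<open>n = 0\<close> the power evaluates to 0, so the uniform constant is
      sought from index 1 on.\<close>
    have pos: "?b n > 0" if "n \<ge> 1" for n using that by simp
    obtain c' where "c' > 0" "\<And>n. n \<ge> 1 \<Longrightarrow> e n \<le> c' * ?b n"
      using eventually_bound_imp_bound[of 1 ?b, OF pos bound] by blast
    then show "\<exists>c::real. c > 0 \<and> (\<forall>n\<ge>1. norm (x n - xbar) \<le> c * ?b n \<and> norm (y n - ybar) \<le> c * ?b n)"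
      by (intro exI[of _ c']) (simp add: e_def)
  qed
qed

end
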